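(* Let $(X,\mathcal{B},\mu)$ be a Lebesgue space and let $T\colon X\to X$ be an invertible measure-preserving transformation. Then the following statements are equivalent: (1) $(X,\mathcal{B},\mu,T)$ has discrete spectrum. (2) For any finite measurable partition $\alpha=\{A_1,\dots,A_l\}$ of $X$ and any $\varepsilon>0$ there exists $C>0$ such that $K(n,\alpha,\varepsilon)\le C$ for all $n\ge 1$.
   Context: A Lebesgue space is a measure space $(X,\mathcal{B},\mu)$ where $(X,\mathcal{B})$ is a standard Borel space and $\mu$ is a regular probability measure on $\mathcal{B}$. No ergodicity is assumed. An eigenfunction is a non-zero $f\in L^2(X,\mu)$ (complex-valued) such that $f\circ T=\lambda f$ for some $\lambda\in\mathbb{C}$. $(X,\mathcal{B},\mu,T)$ has discrete spectrum if the closed linear span of the eigenfunctions is all of $L^2(X,\mu)$. For a finite measurable partition $\alpha=\{A_1,\dots,A_l\}$ of $X$, $x\in X$ and $i\in\mathbb{Z}$, put $\alpha_i(x)=h$ when $T^ix\in A_h$. For $x,y\in X$, $n\ge1$ and $\varepsilon>0$ let $H_n^\alpha(x,y)=\frac1n\#\{0\le i\le n-1:\alpha_i(x)\ne\alpha_i(y)\}$, $B_n^\alpha(x,\varepsilon)=\{y\in X: H_n^\alpha(x,y)<\varepsilon\}$, and $K(n,\alpha,\varepsilon)=\min\{\#(F): F\subset X \text{ finite},\ \mu(\bigcup_{x\in F}B_n^\alpha(x,\varepsilon))>1-\varepsilon\}$, where $\#$ denotes the number of elements. *)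

theory Defs
  imports "HOL-Probability.Probability"
begin

section \<open>Lebesgue spaces and invertible measure-preserving maps\<close>

text \<open>A Polish topology on an arbitrary carrier whose Borel sets are \<open>sets M\<close>.\<close>

definition polish_model :: "'a measure \<Rightarrow> 'a topology \<Rightarrow> bool" where
  "polish_model M S \<longleftrightarrow>
     completely_metrizable_space S \<and> separable_space S \<and> topspace S = space M \<and>
     sets M = sigma_sets (topspace S) {U. openin S U}"

text \<open>Outer regularity by open sets and inner regularity by compact sets.\<close>

definition regular_measure :: "'a measure \<Rightarrow> 'a topology \<Rightarrow> bool" where
  "regular_measure M S \<longleftrightarrow>
     (\<forall>B \<in> sets M.
        emeasure M B = (INF U \<in> {U. B \<subseteq> U \<and> openin S U}. emeasure M U) \<and>
        emeasure M B = (SUP K \<in> {K. K \<subseteq> B \<and> compactin S K}. emeasure M K))"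

text \<open>No completion is taken, and no ergodicity or absence of atoms is assumed.\<close>

definition lebesgue_space :: "'a measure \<Rightarrow> bool" where
  "lebesgue_space M \<longleftrightarrow> prob_space M \<and> (\<exists>S. polish_model M S \<and> regular_measure M S)"

definition invertible_measure_preserving :: "'a measure \<Rightarrow> ('a \<Rightarrow> 'a) \<Rightarrow> bool" where
  "invertible_measure_preserving M T \<longleftrightarrow>
     bij_betw T (space M) (space M) \<and>
     T \<in> measurable M M \<and> inv_into (space M) T \<in> measurable M M \<and>
     distr M M T = M"


section \<open>Discrete spectrum\<close>

text \<open>
  Elements of \<open>L\<^sup>2\<close> are represented by square-integrable functions rather than by their
  almost-everywhere classes, so identities in \<open>L\<^sup>2\<close> are stated almost everywhere.
\<close>

definition L2_space :: "'a measure \<Rightarrow> ('a \<Rightarrow> complex) set" where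
  "L2_space M = {f \<in> borel_measurable M. integrable M (\<lambda>x. (cmod (f x))\<^sup>2)}"

definition L2_dist :: "'a measure \<Rightarrow> ('a \<Rightarrow> complex) \<Rightarrow> ('a \<Rightarrow> complex) \<Rightarrow> real" where
  "L2_dist M f g = sqrt (\<integral>x. (cmod (f x - g x))\<^sup>2 \<partial>M)"

definition eigenfunction :: "'a measure \<Rightarrow> ('a \<Rightarrow> 'a) \<Rightarrow> ('a \<Rightarrow> complex) \<Rightarrow> bool" where
  "eigenfunction M T f \<longleftrightarrow>
     f \<in> L2_space M \<and> \<not> (AE x in M. f x = 0) \<and>
     (\<exists>c::complex. AE x in M. f (T x) = c * f x)"

definition complex_span :: "('a \<Rightarrow> complex) set \<Rightarrow> ('a \<Rightarrow> complex) set" where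
  "complex_span E = {\<lambda>x. \<Sum>f\<in>F. c f * f x | F c. finite F \<and> F \<subseteq> E}"

definition L2_closure :: "'a measure \<Rightarrow> ('a \<Rightarrow> complex) set \<Rightarrow> ('a \<Rightarrow> complex) set" where
  "L2_closure M V = {g \<in> L2_space M. \<forall>\<epsilon>>0. \<exists>h\<in>V. L2_dist M g h < \<epsilon>}"

definition discrete_spectrum :: "'a measure \<Rightarrow> ('a \<Rightarrow> 'a) \<Rightarrow> bool" where
  "discrete_spectrum M T \<longleftrightarrow>
     L2_closure M (complex_span {f. eigenfunction M T f}) = L2_space M"


section \<open>Measure complexity along a partition\<close>

text \<open>The partition \<open>{A 1, \<dots>, A l}\<close> into \<open>l\<close> distinct nonempty measurable cells.\<close>

definition finite_measurable_partition :: "'a measure \<Rightarrow> nat \<Rightarrow> (nat \<Rightarrow> 'a set) \<Rightarrow> bool" where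
  "finite_measurable_partition M l A \<longleftrightarrow>
     A ` {1..l} \<subseteq> sets M \<and> inj_on A {1..l} \<and> partition_on (space M) (A ` {1..l})"

text \<open>
  The index \<open>\<alpha>\<^sub>i(x)\<close> is unique only for \<open>x \<in> space M\<close>, when \<open>A\<close> is a partition of \<open>space M\<close>.
  Only times \<open>i \<ge> 0\<close> enter the Hamming distance, so \<open>i\<close> is a natural number.
\<close>

definition cell_index :: "('a \<Rightarrow> 'a) \<Rightarrow> nat \<Rightarrow> (nat \<Rightarrow> 'a set) \<Rightarrow> nat \<Rightarrow> 'a \<Rightarrow> nat" where
  "cell_index T l A i x = (THE h. h \<in> {1..l} \<and> (T ^^ i) x \<in> A h)"

definition hamming_dist ::
  "('a \<Rightarrow> 'a) \<Rightarrow> nat \<Rightarrow> (nat \<Rightarrow> 'a set) \<Rightarrow> nat \<Rightarrow> 'a \<Rightarrow> 'a \<Rightarrow> real" where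
  "hamming_dist T l A n x y =
     real (card {i. i < n \<and> cell_index T l A i x \<noteq> cell_index T l A i y}) / real n"

definition hamming_ball ::
  "'a measure \<Rightarrow> ('a \<Rightarrow> 'a) \<Rightarrow> nat \<Rightarrow> (nat \<Rightarrow> 'a set) \<Rightarrow> nat \<Rightarrow> 'a \<Rightarrow> real \<Rightarrow> 'a set" where
  "hamming_ball M T l A n x \<epsilon> = {y \<in> space M. hamming_dist T l A n x y < \<epsilon>}"

text \<open>
  For \<open>\<epsilon> > 0\<close> the minimum is over a nonempty set: there are at most \<open>l ^ n\<close> names of length \<open>n\<close>,
  and one centre per occurring name gives balls that cover \<open>space M\<close>.
\<close>

definition measure_complexity ::
  "'a measure \<Rightarrow> ('a \<Rightarrow> 'a) \<Rightarrow> nat \<Rightarrow> nat \<Rightarrow> (nat \<Rightarrow> 'a set) \<Rightarrow> real \<Rightarrow> nat" where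
  "measure_complexity M T n l A \<epsilon> =
     (LEAST k. \<exists>F. finite F \<and> F \<subseteq> space M \<and> card F = k \<and>
        measure M (\<Union>x\<in>F. hamming_ball M T l A n x \<epsilon>) > 1 - \<epsilon>)"

end

theory Submission
  imports Defs
begin

text \<open>
  If the eigenfunctions span, the indicators of the cells are close in \<open>L\<^sup>2\<close> to finite combinations
  of eigenfunctions, whose moduli of differences \<open>\<bar>e x - e y\<bar>\<close> are invariant under \<open>T\<close>; so two points
  at which the finitely many eigenfunctions involved nearly agree stay close in the Hamming
  distance at all times, outside a small set controlled by Markov's inequality.

  Conversely, let \<open>g\<close> be orthogonal to all eigenfunctions.  By the mean ergodic theorem for
  \<open>z T\<close>, made uniform in \<open>z\<close> on the unit circle, and Parseval's identity, the correlations
  \<open>\<langle>g \<circ> T\<^sup>i, g \<circ> T\<^sup>j\<rangle>\<close> are small on average, hence so are \<open>\<langle>w, g \<circ> T\<^sup>i\<rangle>\<close>, uniformly for \<open>w\<close> in the unit ball.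
  Bounded complexity says that on average over \<open>i < n\<close> the functions \<open>1\<^sub>A \<circ> T\<^sup>i\<close> are close to combinations of
  a bounded number of indicators, so \<open>\<langle>1\<^sub>A, g\<rangle> = \<langle>1\<^sub>A \<circ> T\<^sup>i, g \<circ> T\<^sup>i\<rangle>\<close> vanishes for every measurable \<open>A\<close>.
\<close>

section \<open>Square-integrable functions\<close>

text \<open>The classical route uses the spectral measure of \<open>g\<close> and Wiener's lemma,
  which equates the mean square of its Fourier coefficients with the sum of its squared atoms.
  Finite sums take over here: for unimodular \<open>z\<close> the squared norm of the sum of
  \<open>z^i * g(T^i x)\<close> over \<open>i < 2n\<close> is a trigonometric polynomial in
  \<open>z\<close> built from the correlations. Its first two moments over roots of unity turn a
  bound on these norms into a mean-square bound on the correlations. Pointwise convergence in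
  \<open>z\<close> would not do, because each \<open>n\<close> samples the whole circle.

  The order of choices matters: \<open>\<epsilon>\<close> determines \<open>C\<close>; then
  \<open>\<delta>\<close> is taken small against \<open>C\<close>; then \<open>\<delta>\<close>
  yields one length \<open>n\<close>. One \<open>n\<close> is enough because \<open>C\<close> is
  independent of it, but the mixing bound has to hold for all \<open>w\<close> at once, since the
  Hamming balls of length \<open>n\<close> are only known afterwards.

  In the other direction an eigenfunction may be unbounded and of non-constant modulus, as the
  system need not be ergodic. Its values are confined to a disc off a small set, chosen before
  \<open>n\<close>, and only the number of resulting pieces enters the bound.\<close>

definition L2_nrm :: "'a measure \<Rightarrow> ('a \<Rightarrow> complex) \<Rightarrow> real" where
  "L2_nrm M f = sqrt (\<integral>x. (cmod (f x))\<^sup>2 \<partial>M)"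

definition L2_inner :: "'a measure \<Rightarrow> ('a \<Rightarrow> complex) \<Rightarrow> ('a \<Rightarrow> complex) \<Rightarrow> complex" where
  "L2_inner M f g = (\<integral>x. f x * cnj (g x) \<partial>M)"

lemma L2_dist_eq_nrm: "L2_dist M f g = L2_nrm M (\<lambda>x. f x - g x)"
  by (simp add: L2_dist_def L2_nrm_def)

lemma L2_nrm_nonneg [simp]: "L2_nrm M f \<ge> 0"
  by (simp add: L2_nrm_def)

lemma L2_nrm_power2: "(L2_nrm M f)\<^sup>2 = (\<integral>x. (cmod (f x))\<^sup>2 \<partial>M)"
  by (simp add: L2_nrm_def)

lemma L2_space_measurable: "f \<in> L2_space M \<Longrightarrow> f \<in> borel_measurable M"
  by (simp add: L2_space_def)

lemma L2_space_integrable: "f \<in> L2_space M \<Longrightarrow> integrable M (\<lambda>x. (cmod (f x))\<^sup>2)"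
  by (simp add: L2_space_def)

lemma cmod_mult_le_power2: "cmod a * cmod b \<le> (cmod a)\<^sup>2 + (cmod b)\<^sup>2"
proof -
  have "0 \<le> (cmod a - cmod b)\<^sup>2" "0 \<le> (cmod a)\<^sup>2" "0 \<le> (cmod b)\<^sup>2" by simp_all
  then show ?thesis unfolding power2_diff by linarith
qed

lemma L2_space_add:
  assumes "f \<in> L2_space M" "g \<in> L2_space M"
  shows "(\<lambda>x. f x + g x) \<in> L2_space M"
proof -
  note [measurable] = assms[THEN L2_space_measurable]
  have "(cmod (a + b))\<^sup>2 \<le> 2 * (cmod a)\<^sup>2 + 2 * (cmod b)\<^sup>2" for a b :: complex
  proof -
    have "(cmod (a + b))\<^sup>2 \<le> (cmod a + cmod b)\<^sup>2"
      by (intro power_mono norm_triangle_ineq) simp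
    also have "\<dots> \<le> 2 * (cmod a)\<^sup>2 + 2 * (cmod b)\<^sup>2"
    proof -
      have "0 \<le> (cmod a - cmod b)\<^sup>2" by simp
      then show ?thesis unfolding power2_diff power2_sum by linarith
    qed
    finally show ?thesis .
  qed
  then have "AE x in M. norm ((cmod (f x + g x))\<^sup>2) \<le> norm (2 * (cmod (f x))\<^sup>2 + 2 * (cmod (g x))\<^sup>2)"
    by (intro AE_I2) simp
  moreover have "integrable M (\<lambda>x. 2 * (cmod (f x))\<^sup>2 + 2 * (cmod (g x))\<^sup>2)"
    by (intro Bochner_Integration.integrable_add integrable_mult_right L2_space_integrable assms)
  moreover have "(\<lambda>x. (cmod (f x + g x))\<^sup>2) \<in> borel_measurable M" by measurable
  ultimately have "integrable M (\<lambda>x. (cmod (f x + g x))\<^sup>2)"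
    using Bochner_Integration.integrable_bound by blast
  then show ?thesis by (simp add: L2_space_def)
qed

lemma L2_space_scale:
  assumes "f \<in> L2_space M"
  shows "(\<lambda>x. c * f x) \<in> L2_space M"
  using assms by (auto simp: L2_space_def norm_mult power_mult_distrib)

lemma L2_space_diff:
  assumes "f \<in> L2_space M" "g \<in> L2_space M"
  shows "(\<lambda>x. f x - g x) \<in> L2_space M"
  using L2_space_add[OF assms(1) L2_space_scale[OF assms(2), of "-1"]] by simp

lemma L2_space_zero: "(\<lambda>_. 0) \<in> L2_space M"
  by (simp add: L2_space_def)

lemma L2_space_sum:
  assumes "\<And>i. i \<in> I \<Longrightarrow> f i \<in> L2_space M"
  shows "(\<lambda>x. \<Sum>i\<in>I. f i x) \<in> L2_space M"
  using assms
  by (induction I rule: infinite_finite_induct) (auto intro!: L2_space_add L2_space_zero)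

lemma integrable_cmod_mult:
  assumes "f \<in> L2_space M" "g \<in> L2_space M"
  shows "integrable M (\<lambda>x. cmod (f x) * cmod (g x))"
proof -
  note [measurable] = assms[THEN L2_space_measurable]
  have "AE x in M. norm (cmod (f x) * cmod (g x)) \<le> norm ((cmod (f x))\<^sup>2 + (cmod (g x))\<^sup>2)"
    using cmod_mult_le_power2 by (intro AE_I2) simp
  moreover have "integrable M (\<lambda>x. (cmod (f x))\<^sup>2 + (cmod (g x))\<^sup>2)"
    by (intro Bochner_Integration.integrable_add L2_space_integrable assms)
  moreover have "(\<lambda>x. cmod (f x) * cmod (g x)) \<in> borel_measurable M" by measurable
  ultimately show ?thesis
    using Bochner_Integration.integrable_bound by blast
qed

lemma integrable_L2_mult:
  assumes "f \<in> L2_space M" "g \<in> L2_space M"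
  shows "integrable M (\<lambda>x. f x * cnj (g x))"
proof -
  note [measurable] = assms[THEN L2_space_measurable]
  have [measurable]: "(\<lambda>x. cnj (g x)) \<in> borel_measurable M"
    by (intro borel_measurable_continuous_on[OF continuous_on_cnj]) (auto intro: continuous_on_id)
  show ?thesis
    by (rule Bochner_Integration.integrable_bound[OF integrable_cmod_mult[OF assms]])
       (auto simp: norm_mult)
qed

lemma L2_inner_self: "L2_inner M f f = complex_of_real ((L2_nrm M f)\<^sup>2)"
proof -
  have "L2_inner M f f = (\<integral>x. complex_of_real ((cmod (f x))\<^sup>2) \<partial>M)"
    by (simp only: L2_inner_def complex_norm_square)
  then show ?thesis by (simp only: L2_nrm_power2 integral_complex_of_real)
qed

lemma L2_inner_cnj: "cnj (L2_inner M f g) = L2_inner M g f"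
proof -
  have "cnj (L2_inner M f g) = (\<integral>x. cnj (f x * cnj (g x)) \<partial>M)"
    unfolding L2_inner_def by (rule Bochner_Integration.integral_cnj[symmetric])
  also have "\<dots> = L2_inner M g f"
    by (simp add: L2_inner_def mult.commute)
  finally show ?thesis .
qed

lemma L2_inner_add_left:
  "\<lbrakk>f \<in> L2_space M; g \<in> L2_space M; h \<in> L2_space M\<rbrakk>
    \<Longrightarrow> L2_inner M (\<lambda>x. f x + g x) h = L2_inner M f h + L2_inner M g h"
  by (simp add: L2_inner_def integrable_L2_mult distrib_right)

lemma L2_inner_diff_left:
  "\<lbrakk>f \<in> L2_space M; g \<in> L2_space M; h \<in> L2_space M\<rbrakk>
    \<Longrightarrow> L2_inner M (\<lambda>x. f x - g x) h = L2_inner M f h - L2_inner M g h"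
  by (simp add: L2_inner_def integrable_L2_mult left_diff_distrib)

lemma L2_inner_scale_left: "L2_inner M (\<lambda>x. c * f x) h = c * L2_inner M f h"
  by (simp add: L2_inner_def mult.assoc)

lemma L2_inner_scale_right: "L2_inner M h (\<lambda>x. c * f x) = cnj c * L2_inner M h f"
  by (metis L2_inner_cnj L2_inner_scale_left complex_cnj_mult)

lemma L2_inner_sum_left:
  assumes "\<And>i. i \<in> I \<Longrightarrow> f i \<in> L2_space M" "h \<in> L2_space M"
  shows "L2_inner M (\<lambda>x. \<Sum>i\<in>I. f i x) h = (\<Sum>i\<in>I. L2_inner M (f i) h)"
proof -
  have "L2_inner M (\<lambda>x. \<Sum>i\<in>I. f i x) h = (\<integral>x. (\<Sum>i\<in>I. f i x * cnj (h x)) \<partial>M)"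
    by (simp only: L2_inner_def sum_distrib_right)
  also have "\<dots> = (\<Sum>i\<in>I. L2_inner M (f i) h)"
    unfolding L2_inner_def by (intro Bochner_Integration.integral_sum integrable_L2_mult assms)
  finally show ?thesis .
qed

lemma L2_inner_sum_right:
  assumes "\<And>i. i \<in> I \<Longrightarrow> f i \<in> L2_space M" "h \<in> L2_space M"
  shows "L2_inner M h (\<lambda>x. \<Sum>i\<in>I. f i x) = (\<Sum>i\<in>I. L2_inner M h (f i))"
  using arg_cong[OF L2_inner_sum_left[OF assms], where f=cnj] by (simp add: L2_inner_cnj)

text \<open>Keeping the moduli inside the integral serves two purposes: it bounds
  \<open>L2_inner\<close> and, with second factor 1, it compares the L1 norm with the L2
  norm.\<close>

lemma L2_Cauchy_Schwarz_abs:
  assumes "f \<in> L2_space M" "g \<in> L2_space M"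
  shows "(\<integral>x. cmod (f x) * cmod (g x) \<partial>M) \<le> L2_nrm M f * L2_nrm M g"
proof -
  note [measurable] = assms[THEN L2_space_measurable]
  have "ennreal ((\<integral>x. cmod (f x) * cmod (g x) \<partial>M)\<^sup>2)
      = (\<integral>\<^sup>+x. ennreal (cmod (f x)) * ennreal (cmod (g x)) \<partial>M)\<^sup>2"
    using integrable_cmod_mult[OF assms]
    by (simp add: nn_integral_eq_integral ennreal_power flip: ennreal_mult)
  also have "\<dots> \<le> (\<integral>\<^sup>+x. (ennreal (cmod (f x)))\<^sup>2 \<partial>M) * (\<integral>\<^sup>+x. (ennreal (cmod (g x)))\<^sup>2 \<partial>M)"
    by (rule Cauchy_Schwarz_nn_integral) auto
  also have "\<dots> = ennreal ((L2_nrm M f * L2_nrm M g)\<^sup>2)"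
    using assms[THEN L2_space_integrable]
    by (simp add: ennreal_power nn_integral_eq_integral L2_nrm_power2 power_mult_distrib ennreal_mult)
  finally have "(\<integral>x. cmod (f x) * cmod (g x) \<partial>M)\<^sup>2 \<le> (L2_nrm M f * L2_nrm M g)\<^sup>2"
    by simp
  then show ?thesis
    by (rule power2_le_imp_le) simp
qed

lemma L2_Cauchy_Schwarz:
  assumes "f \<in> L2_space M" "g \<in> L2_space M"
  shows "cmod (L2_inner M f g) \<le> L2_nrm M f * L2_nrm M g"
proof -
  have "cmod (L2_inner M f g) \<le> (\<integral>x. cmod (f x) * cmod (g x) \<partial>M)"
    unfolding L2_inner_def
    by (rule order_trans[OF integral_norm_bound]) (simp add: norm_mult)
  also note L2_Cauchy_Schwarz_abs[OF assms]
  finally show ?thesis .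
qed

lemma L2_nrm_add_power2:
  assumes "f \<in> L2_space M" "g \<in> L2_space M"
  shows "(L2_nrm M (\<lambda>x. f x + g x))\<^sup>2 = (L2_nrm M f)\<^sup>2 + (L2_nrm M g)\<^sup>2 + 2 * Re (L2_inner M f g)"
proof -
  have "complex_of_real ((L2_nrm M (\<lambda>x. f x + g x))\<^sup>2) =
      L2_inner M (\<lambda>x. f x + g x) (\<lambda>x. f x + g x)"
    by (simp add: L2_inner_self)
  also have "\<dots> = L2_inner M f (\<lambda>x. f x + g x) + L2_inner M g (\<lambda>x. f x + g x)"
    using assms by (simp add: L2_inner_add_left L2_space_add)
  also have "\<dots> = L2_inner M f f + L2_inner M g g + (L2_inner M f g + cnj (L2_inner M f g))"
    using assms arg_cong[OF L2_inner_add_left[of f M g f], where f=cnj] arg_cong[OF L2_inner_add_left[of f M g g], where f=cnj]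
    by (simp add: L2_inner_cnj)
  also have "\<dots> = complex_of_real ((L2_nrm M f)\<^sup>2 + (L2_nrm M g)\<^sup>2 + 2 * Re (L2_inner M f g))"
    by (simp add: L2_inner_self complex_add_cnj)
  finally show ?thesis
    using of_real_eq_iff by blast
qed

lemma L2_nrm_scale: "L2_nrm M (\<lambda>x. c * f x) = cmod c * L2_nrm M f"
  by (simp add: L2_nrm_def norm_mult power_mult_distrib real_sqrt_mult)

lemma L2_nrm_minus_commute: "L2_nrm M (\<lambda>x. f x - g x) = L2_nrm M (\<lambda>x. g x - f x)"
  by (simp add: L2_nrm_def norm_minus_commute)

lemma L2_nrm_diff_power2:
  assumes "f \<in> L2_space M" "g \<in> L2_space M"
  shows "(L2_nrm M (\<lambda>x. f x - g x))\<^sup>2 = (L2_nrm M f)\<^sup>2 + (L2_nrm M g)\<^sup>2 - 2 * Re (L2_inner M f g)"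
  using L2_nrm_add_power2[OF assms(1) L2_space_scale[OF assms(2), of "-1"]]
    L2_nrm_scale[of M "-1" g] L2_inner_scale_right[of M f "-1" g]
  by simp

lemma L2_parallelogram:
  assumes "f \<in> L2_space M" "g \<in> L2_space M"
  shows "(L2_nrm M (\<lambda>x. f x + g x))\<^sup>2 + (L2_nrm M (\<lambda>x. f x - g x))\<^sup>2
      = 2 * (L2_nrm M f)\<^sup>2 + 2 * (L2_nrm M g)\<^sup>2"
  by (simp add: L2_nrm_add_power2 L2_nrm_diff_power2 assms)

lemma L2_nrm_triangle:
  assumes "f \<in> L2_space M" "g \<in> L2_space M"
  shows "L2_nrm M (\<lambda>x. f x + g x) \<le> L2_nrm M f + L2_nrm M g"
proof (rule power2_le_imp_le)
  have "Re (L2_inner M f g) \<le> L2_nrm M f * L2_nrm M g"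
    using L2_Cauchy_Schwarz[OF assms] complex_Re_le_cmod order_trans by blast
  then show "(L2_nrm M (\<lambda>x. f x + g x))\<^sup>2 \<le> (L2_nrm M f + L2_nrm M g)\<^sup>2"
    by (simp add: L2_nrm_add_power2 assms power2_sum)
qed simp

lemma L2_nrm_triangle_diff:
  assumes "f \<in> L2_space M" "g \<in> L2_space M" "h \<in> L2_space M"
  shows "L2_nrm M (\<lambda>x. f x - h x) \<le> L2_nrm M (\<lambda>x. f x - g x) + L2_nrm M (\<lambda>x. g x - h x)"
  using L2_nrm_triangle[of "\<lambda>x. f x - g x" M "\<lambda>x. g x - h x"] assms
  by (simp add: L2_space_diff)

lemma L2_nrm_zero: "L2_nrm M (\<lambda>_. 0) = 0"
  by (simp add: L2_nrm_def)

lemma L2_nrm_sum: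
  assumes "\<And>i. i \<in> I \<Longrightarrow> f i \<in> L2_space M"
  shows "L2_nrm M (\<lambda>x. \<Sum>i\<in>I. f i x) \<le> (\<Sum>i\<in>I. L2_nrm M (f i))"
  using assms
proof (induction I rule: infinite_finite_induct)
  case (insert i I)
  then show ?case
    using L2_nrm_triangle[of "f i" M "\<lambda>x. \<Sum>i\<in>I. f i x"]
    by (force simp: L2_space_sum)
qed (simp_all add: L2_nrm_zero)

lemma L2_nrm_eq_0_iff:
  assumes "f \<in> L2_space M"
  shows "L2_nrm M f = 0 \<longleftrightarrow> (AE x in M. f x = 0)"
  using integral_nonneg_eq_0_iff_AE[OF L2_space_integrable[OF assms]]
  by (simp add: L2_nrm_def)

section \<open>Completeness of L2 and orthogonal projection\<close>

lemma (in finite_measure) L2_space_integrable1: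
  assumes "f \<in> L2_space M"
  shows "integrable M f"
proof -
  note [measurable] = L2_space_measurable[OF assms]
  have "integrable M (\<lambda>x. cmod (f x))"
    by (rule square_integrable_imp_integrable) (use L2_space_integrable[OF assms] in auto)
  then show ?thesis by (subst (asm) integrable_norm_iff) auto
qed

lemma (in prob_space) L2_space_const: "(\<lambda>_. c) \<in> L2_space M"
  by (simp add: L2_space_def)

lemma (in prob_space) L1_le_L2:
  assumes "f \<in> L2_space M"
  shows "(\<integral>x. cmod (f x) \<partial>M) \<le> L2_nrm M f"
  using L2_Cauchy_Schwarz_abs[OF assms L2_space_const[of 1]]
  by (simp add: L2_nrm_def prob_space)

text \<open>Riesz-Fischer: over a probability measure an L2-Cauchy sequence is L1-Cauchy, so a
  subsequence converges almost everywhere. Fatou's lemma along that subsequence bounds the L2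
  distance from every late \<open>f m\<close> to the limit.\<close>

lemma (in prob_space) L2_complete:
  assumes f: "\<And>n. f n \<in> L2_space M"
    and cauchy: "\<And>e. e > 0 \<Longrightarrow> \<exists>N. \<forall>m\<ge>N. \<forall>n\<ge>N. L2_nrm M (\<lambda>x. f m x - f n x) < e"
  shows "\<exists>h\<in>L2_space M. (\<lambda>n. L2_nrm M (\<lambda>x. f n x - h x)) \<longlonglongrightarrow> 0"
proof -
  have [measurable]: "f n \<in> borel_measurable M" for n
    using f by (rule L2_space_measurable)
  have L1: "\<exists>N. \<forall>i\<ge>N. \<forall>j\<ge>N. (\<integral>x. norm (f i x - f j x) \<partial>M) < e" if "e > 0" for e
    using cauchy[OF that] L1_le_L2[OF L2_space_diff[OF f f]] by (meson le_less_trans)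
  obtain r where r: "strict_mono r" and "AE x in M. Cauchy (\<lambda>i. f (r i) x)"
    using cauchy_L1_AE_cauchy_subseq[of M f, OF L2_space_integrable1[OF f] L1] by blast
  then have AE_lim: "AE x in M. (\<lambda>i. f (r i) x) \<longlonglongrightarrow> lim (\<lambda>i. f (r i) x)"
    by (auto simp: Cauchy_convergent_iff convergent_LIMSEQ_iff)
  \<comment> \<open>On the null set where the subsequence diverges, \<open>lim\<close> takes an
    unspecified value; \<open>h\<close> is measurable all the same.\<close>
  define h where "h = (\<lambda>x. lim (\<lambda>i. f (r i) x))"
  have [measurable]: "h \<in> borel_measurable M" unfolding h_def by measurable
  have dist_h: "(\<integral>\<^sup>+x. ennreal ((cmod (f m x - h x))\<^sup>2) \<partial>M) \<le> ennreal (e\<^sup>2)"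
    if e: "e > 0" and N: "\<forall>m\<ge>N. \<forall>n\<ge>N. L2_nrm M (\<lambda>x. f m x - f n x) < e" and m: "m \<ge> N" for e N m
  proof -
    have "(\<integral>\<^sup>+x. ennreal ((cmod (f m x - h x))\<^sup>2) \<partial>M)
        = (\<integral>\<^sup>+x. liminf (\<lambda>i. ennreal ((cmod (f m x - f (r i) x))\<^sup>2)) \<partial>M)"
    proof (rule nn_integral_cong_AE)
      show "AE x in M. ennreal ((cmod (f m x - h x))\<^sup>2)
          = liminf (\<lambda>i. ennreal ((cmod (f m x - f (r i) x))\<^sup>2))"
        using AE_lim
      proof eventually_elim
        case (elim x)
        then have "(\<lambda>i. ennreal ((cmod (f m x - f (r i) x))\<^sup>2)) \<longlonglongrightarrow> ennreal ((cmod (f m x - h x))\<^sup>2)"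
          unfolding h_def by (intro tendsto_intros)
        then show ?case
          by (rule lim_imp_Liminf[OF sequentially_bot, THEN sym])
      qed
    qed
    also have "\<dots> \<le> liminf (\<lambda>i. \<integral>\<^sup>+x. ennreal ((cmod (f m x - f (r i) x))\<^sup>2) \<partial>M)"
      by (rule nn_integral_liminf) auto
    also have "\<dots> \<le> ennreal (e\<^sup>2)"
    proof (rule Liminf_le)
      show "\<forall>\<^sub>F i in sequentially. (\<integral>\<^sup>+x. ennreal ((cmod (f m x - f (r i) x))\<^sup>2) \<partial>M) \<le> ennreal (e\<^sup>2)"
        using eventually_ge_at_top[of N]
      proof eventually_elim
        case (elim i)
        then have "r i \<ge> N" using r seq_suble order_trans by blast
        then have "(L2_nrm M (\<lambda>x. f m x - f (r i) x))\<^sup>2 \<le> e\<^sup>2"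
          using N m by (intro power_mono) (auto intro: less_imp_le)
        then show ?case
          unfolding L2_nrm_power2
          by (subst nn_integral_eq_integral[OF L2_space_integrable[OF L2_space_diff[OF f f]]])
             (simp_all add: ennreal_leI)
      qed
    qed auto
    finally show ?thesis .
  qed
  have diff_L2: "(\<lambda>x. f m x - h x) \<in> L2_space M \<and> L2_nrm M (\<lambda>x. f m x - h x) \<le> e"
    if e: "e > 0" and N: "\<forall>m\<ge>N. \<forall>n\<ge>N. L2_nrm M (\<lambda>x. f m x - f n x) < e" and m: "m \<ge> N" for e N m
  proof
    have int: "integrable M (\<lambda>x. (cmod (f m x - h x))\<^sup>2)"
    proof (rule integrableI_bounded)
      show "(\<integral>\<^sup>+x. ennreal (norm ((cmod (f m x - h x))\<^sup>2)) \<partial>M) < \<infinity>"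
        using le_less_trans[OF dist_h[OF that] ennreal_less_top] by simp
    qed measurable
    then show "(\<lambda>x. f m x - h x) \<in> L2_space M"
      by (simp add: L2_space_def)
    have "ennreal ((L2_nrm M (\<lambda>x. f m x - h x))\<^sup>2) = (\<integral>\<^sup>+x. ennreal ((cmod (f m x - h x))\<^sup>2) \<partial>M)"
      unfolding L2_nrm_power2 by (rule nn_integral_eq_integral[OF int, symmetric]) simp
    also note dist_h[OF that]
    finally have "(L2_nrm M (\<lambda>x. f m x - h x))\<^sup>2 \<le> e\<^sup>2" by simp
    then show "L2_nrm M (\<lambda>x. f m x - h x) \<le> e"
      by (rule power2_le_imp_le) (use e in simp)
  qed
  obtain N where "\<forall>m\<ge>N. \<forall>n\<ge>N. L2_nrm M (\<lambda>x. f m x - f n x) < 1"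
    using cauchy[of 1] by auto
  then have "(\<lambda>x. f N x - h x) \<in> L2_space M" using diff_L2[of 1 N N] by simp
  from L2_space_diff[OF f[of N] this] have "h \<in> L2_space M" by simp
  moreover have "(\<lambda>n. L2_nrm M (\<lambda>x. f n x - h x)) \<longlonglongrightarrow> 0"
  proof (rule LIMSEQ_I)
    fix e :: real assume "e > 0"
    then obtain N where "\<forall>m\<ge>N. \<forall>n\<ge>N. L2_nrm M (\<lambda>x. f m x - f n x) < e / 2"
      using cauchy[of "e / 2"] by auto
    then have "L2_nrm M (\<lambda>x. f n x - h x) \<le> e / 2" if "n \<ge> N" for n
      using diff_L2[of "e / 2" N n] \<open>e > 0\<close> that by simp
    then have "norm (L2_nrm M (\<lambda>x. f n x - h x) - 0) < e" if "n \<ge> N" for n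
      using \<open>e > 0\<close> that by fastforce
    then show "\<exists>N. \<forall>n\<ge>N. norm (L2_nrm M (\<lambda>x. f n x - h x) - 0) < e" by blast
  qed
  ultimately show ?thesis by blast
qed

text \<open>With \<open>w\<close> the inner product of \<open>h\<close> and \<open>v\<close>, and
  \<open>s\<close> the squared norm of \<open>v\<close>, the choice \<open>t = w / s\<close> lowers
  the squared norm of \<open>h\<close> by \<open>|w|^2 / s\<close>, so minimality forces
  \<open>w = 0\<close>.\<close>

lemma L2_inner_eq_0_if_minimal:
  assumes "h \<in> L2_space M" "v \<in> L2_space M"
    and min: "\<And>t. (L2_nrm M h)\<^sup>2 \<le> (L2_nrm M (\<lambda>x. h x - t * v x))\<^sup>2"
  shows "L2_inner M v h = 0"
proof (cases "L2_nrm M v = 0")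
  case True
  then show ?thesis using L2_Cauchy_Schwarz[OF assms(2,1)] by simp
next
  case False
  define s where "s = (L2_nrm M v)\<^sup>2"
  define w where "w = L2_inner M h v"
  have s: "s > 0" using False by (simp add: s_def)
  have "(L2_nrm M (\<lambda>x. h x - (w / s) * v x))\<^sup>2
      = (L2_nrm M h)\<^sup>2 + (cmod (w / s))\<^sup>2 * s - 2 * Re (cnj (w / s) * w)"
    by (simp only: L2_nrm_diff_power2 L2_space_scale assms L2_nrm_scale L2_inner_scale_right
        power_mult_distrib s_def w_def)
  also have "cnj (w / s) * w = complex_of_real ((cmod w)\<^sup>2 / s)"
    by (simp only: of_real_divide complex_norm_square complex_cnj_divide
        complex_cnj_complex_of_real times_divide_eq_left times_divide_eq_right mult.commute)
  also have "(cmod (w / s))\<^sup>2 * s = (cmod w)\<^sup>2 / s"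
    using s by (simp add: norm_divide power_divide power2_eq_square)
  finally have "(cmod w)\<^sup>2 / s \<le> 0" using min[of "w / s"] by simp
  then have "w = 0" using s by (simp add: divide_le_0_iff)
  then show ?thesis using L2_inner_cnj[of M h v] by (simp add: w_def)
qed

text \<open>The witness is the residual \<open>f - p\<close>, where \<open>p\<close> is the limit of
  a minimising sequence in \<open>V\<close>. As \<open>V\<close> is not assumed closed,
  \<open>p\<close> may lie outside it, and every property of \<open>p\<close> is obtained by passing
  to the limit.\<close>

lemma (in prob_space) L2_projection:
  assumes f: "f \<in> L2_space M" and V: "V \<subseteq> L2_space M" "V \<noteq> {}"
    and lin: "\<And>u v c. u \<in> V \<Longrightarrow> v \<in> V \<Longrightarrow> (\<lambda>x. u x + c * v x) \<in> V"
    and notin: "f \<notin> L2_closure M V"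
  shows "\<exists>h\<in>L2_space M. (\<forall>v\<in>V. L2_inner M v h = 0) \<and> L2_inner M f h \<noteq> 0"
proof -
  define d where "d = (INF v\<in>V. (L2_nrm M (\<lambda>x. f x - v x))\<^sup>2)"
  have bdd: "bdd_below ((\<lambda>v. (L2_nrm M (\<lambda>x. f x - v x))\<^sup>2) ` V)"
    by (rule bdd_belowI[of _ 0]) auto
  have d_le: "d \<le> (L2_nrm M (\<lambda>x. f x - v x))\<^sup>2" if "v \<in> V" for v
    unfolding d_def by (rule cINF_lower[OF bdd that])
  have "\<exists>v\<in>V. (L2_nrm M (\<lambda>x. f x - v x))\<^sup>2 < d + e" if "e > 0" for e
    using that cINF_less_iff[OF V(2) bdd, of "d + e"] by (simp add: d_def)
  then have "\<forall>n. \<exists>v. v \<in> V \<and> (L2_nrm M (\<lambda>x. f x - v x))\<^sup>2 < d + 1 / real (Suc n)"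
    by (metis of_nat_0_less_iff zero_less_Suc zero_less_divide_1_iff)
  then obtain v where vV: "\<And>n. v n \<in> V"
    and v: "\<And>n. (L2_nrm M (\<lambda>x. f x - v n x))\<^sup>2 < d + 1 / real (Suc n)"
    by metis
  have vL2: "v n \<in> L2_space M" for n using vV V by blast
  \<comment> \<open>Parallelogram law for \<open>f - v m\<close> and \<open>f - v n\<close>: their
    sum is twice the difference of \<open>f\<close> and a midpoint in \<open>V\<close>, hence has
    squared norm at least \<open>4 * d\<close>.\<close>
  have close: "(L2_nrm M (\<lambda>x. v m x - v n x))\<^sup>2 \<le> 2 / real (Suc m) + 2 / real (Suc n)" for m n
  proof -
    \<comment> \<open>\<open>lin\<close> offers only combinations \<open>u + c * v\<close>, so the
      midpoint is reached starting from the zero function.\<close>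
    have zV: "(\<lambda>x. 0) \<in> V" using lin[OF vV[of 0] vV[of 0], of "-1"] by simp
    have "(\<lambda>x. 0 + (1/2) * (v m x + 1 * v n x)) \<in> V"
      by (intro lin zV vV)
    then have "d \<le> (L2_nrm M (\<lambda>x. f x - (1/2) * (v m x + v n x)))\<^sup>2"
      using d_le by simp
    also have "(\<lambda>x. f x - (1/2) * (v m x + v n x)) = (\<lambda>x. (1/2) * ((f x - v m x) + (f x - v n x)))"
      by (simp add: algebra_simps)
    also have "(L2_nrm M \<dots>)\<^sup>2 = (1/4) * (L2_nrm M (\<lambda>x. (f x - v m x) + (f x - v n x)))\<^sup>2"
      by (subst L2_nrm_scale) (simp add: power_mult_distrib power2_eq_square)
    finally have "4 * d \<le> (L2_nrm M (\<lambda>x. (f x - v m x) + (f x - v n x)))\<^sup>2" by simp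
    moreover have "L2_nrm M (\<lambda>x. v m x - v n x) = L2_nrm M (\<lambda>x. (f x - v m x) - (f x - v n x))"
      by (subst L2_nrm_minus_commute) simp
    ultimately show ?thesis
      using L2_parallelogram[OF L2_space_diff[OF f vL2[of m]] L2_space_diff[OF f vL2[of n]]]
        v[of m] v[of n] by simp
  qed
  have "\<exists>N. \<forall>m\<ge>N. \<forall>n\<ge>N. L2_nrm M (\<lambda>x. v m x - v n x) < e" if "e > 0" for e
  proof -
    obtain N where N: "4 / e\<^sup>2 < real N" using reals_Archimedean2 by blast
    have "L2_nrm M (\<lambda>x. v m x - v n x) < e" if "m \<ge> N" "n \<ge> N" for m n
    proof (rule power2_less_imp_less)
      have 1: "2 / real (Suc k) < e\<^sup>2 / 2" if "k \<ge> N" for k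
      proof -
        have "4 / e\<^sup>2 < real (Suc k)" using N that by linarith
        then show ?thesis using \<open>e > 0\<close> by (simp add: field_simps)
      qed
      show "(L2_nrm M (\<lambda>x. v m x - v n x))\<^sup>2 < e\<^sup>2"
        using close[of m n] 1[OF \<open>m \<ge> N\<close>] 1[OF \<open>n \<ge> N\<close>] by linarith
    qed (use \<open>e > 0\<close> in simp)
    then show ?thesis by blast
  qed
  then obtain p where p: "p \<in> L2_space M" and vp: "(\<lambda>n. L2_nrm M (\<lambda>x. v n x - p x)) \<longlonglongrightarrow> 0"
    using L2_complete[of v] vL2 by blast
  define h where "h = (\<lambda>x. f x - p x)"
  have h: "h \<in> L2_space M" unfolding h_def by (intro L2_space_diff f p)
  have nrm_h: "(L2_nrm M h)\<^sup>2 \<le> d"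
  proof (rule LIMSEQ_le)
    let ?a = "\<lambda>n. sqrt (d + 1 / real (Suc n)) + L2_nrm M (\<lambda>x. v n x - p x)"
    have "(\<lambda>n. (?a n)\<^sup>2) \<longlonglongrightarrow> (sqrt (d + 0) + 0)\<^sup>2"
      by (intro tendsto_intros vp LIMSEQ_Suc[OF lim_1_over_n])
    moreover have "d \<ge> 0" unfolding d_def using V by (intro cINF_greatest) auto
    ultimately show "(\<lambda>n. (?a n)\<^sup>2) \<longlonglongrightarrow> d" by simp
    have "L2_nrm M h \<le> ?a n" for n
    proof -
      have "L2_nrm M (\<lambda>x. f x - v n x) \<le> sqrt (d + 1 / real (Suc n))"
        using v[of n] by (intro real_le_rsqrt) simp
      then show ?thesis
        using L2_nrm_triangle_diff[OF f vL2[of n] p] by (simp add: h_def)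
    qed
    then show "\<exists>N. \<forall>n\<ge>N. (L2_nrm M h)\<^sup>2 \<le> (?a n)\<^sup>2"
      by (intro exI[of _ 0] allI impI power_mono) auto
  qed auto
  have d_le_h: "d \<le> (L2_nrm M (\<lambda>x. h x - u x))\<^sup>2" if u: "u \<in> V" for u
  proof (rule LIMSEQ_le)
    have uL2: "u \<in> L2_space M" using u V by blast
    let ?a = "\<lambda>n. L2_nrm M (\<lambda>x. h x - u x) + L2_nrm M (\<lambda>x. v n x - p x)"
    have "(\<lambda>n. (?a n)\<^sup>2) \<longlonglongrightarrow> (L2_nrm M (\<lambda>x. h x - u x) + 0)\<^sup>2"
      by (intro tendsto_intros vp)
    then show "(\<lambda>n. (?a n)\<^sup>2) \<longlonglongrightarrow> (L2_nrm M (\<lambda>x. h x - u x))\<^sup>2" by simp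
    have "d \<le> (?a n)\<^sup>2" for n
    proof -
      have "(\<lambda>x. u x + 1 * v n x) \<in> V" by (intro lin u vV)
      then have "d \<le> (L2_nrm M (\<lambda>x. f x - (u x + v n x)))\<^sup>2" using d_le by simp
      also have "\<dots> \<le> (?a n)\<^sup>2"
      proof (rule power_mono)
        have "L2_nrm M (\<lambda>x. f x - (u x + v n x)) = L2_nrm M (\<lambda>x. (h x - u x) + (p x - v n x))"
          by (simp add: h_def algebra_simps)
        also have "\<dots> \<le> L2_nrm M (\<lambda>x. h x - u x) + L2_nrm M (\<lambda>x. p x - v n x)"
          by (intro L2_nrm_triangle L2_space_diff h uL2 p vL2)
        finally show "L2_nrm M (\<lambda>x. f x - (u x + v n x)) \<le> ?a n"
          using L2_nrm_minus_commute[of M p] by simp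
      qed simp
      finally show ?thesis .
    qed
    then show "\<exists>N. \<forall>n\<ge>N. d \<le> (?a n)\<^sup>2" by blast
  qed auto
  have orth: "L2_inner M u h = 0" if u: "u \<in> V" for u
  proof (rule L2_inner_eq_0_if_minimal[OF h])
    show "u \<in> L2_space M" using u V by blast
    fix t
    have "(\<lambda>x. u x + (-1) * u x) \<in> V" by (intro lin u)
    then have "(\<lambda>x. (u x + (-1) * u x) + t * u x) \<in> V" by (rule lin) (rule u)
    then have "(\<lambda>x. t * u x) \<in> V" by simp
    from d_le_h[OF this] nrm_h show "(L2_nrm M h)\<^sup>2 \<le> (L2_nrm M (\<lambda>x. h x - t * u x))\<^sup>2" by linarith
  qed
  have "L2_inner M p h = 0"
  proof -
    have "cmod (L2_inner M p h) \<le> L2_nrm M (\<lambda>x. v n x - p x) * L2_nrm M h" for n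
    proof -
      have "L2_inner M (\<lambda>x. v n x - p x) h = - L2_inner M p h"
        using orth[OF vV] by (simp add: L2_inner_diff_left vL2 p h)
      then show ?thesis
        using L2_Cauchy_Schwarz[OF L2_space_diff[OF vL2 p] h] by (metis norm_minus_cancel)
    qed
    then have "cmod (L2_inner M p h) \<le> 0 * L2_nrm M h"
      by (intro LIMSEQ_le_const[OF tendsto_mult[OF vp tendsto_const]]) blast
    then show ?thesis by simp
  qed
  \<comment> \<open>Since \<open>f = h + p\<close> and \<open>p\<close> is orthogonal to
    \<open>h\<close>, the pairing is the squared norm of \<open>h\<close>; it vanishes only if
    \<open>d = 0\<close>, that is, if \<open>f\<close> is in the closure.\<close>
  then have "L2_inner M f h = complex_of_real ((L2_nrm M h)\<^sup>2)"
    using L2_inner_diff_left[OF f p h] L2_inner_self[of M h] by (simp add: h_def)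
  moreover have "L2_nrm M h \<noteq> 0"
  proof
    assume 0: "L2_nrm M h = 0"
    have "\<exists>u\<in>V. L2_dist M f u < e" if "e > 0" for e
    proof -
      have "d \<le> 0"
      proof -
        have "(\<lambda>x. v 0 x + (-1) * v 0 x) \<in> V" by (intro lin vV)
        from d_le_h[OF this] 0 show ?thesis by simp
      qed
      obtain n where "1 / real (Suc n) < e\<^sup>2"
        using \<open>e > 0\<close> reals_Archimedean[of "e\<^sup>2"] by (auto simp: inverse_eq_divide)
      with v[of n] \<open>d \<le> 0\<close> have "(L2_nrm M (\<lambda>x. f x - v n x))\<^sup>2 < e\<^sup>2" by linarith
      then have "L2_nrm M (\<lambda>x. f x - v n x) < e"
        by (rule power2_less_imp_less) (use \<open>e > 0\<close> in simp)
      then show ?thesis using vV by (auto simp: L2_dist_eq_nrm)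
    qed
    then show False using notin f by (simp add: L2_closure_def)
  qed
  ultimately have "L2_inner M f h \<noteq> 0" by simp
  with h orth show ?thesis by blast
qed

section \<open>Twisted ergodic averages\<close>

lemma sum_lessThan_add:
  fixes f :: "nat \<Rightarrow> 'b::comm_monoid_add"
  shows "(\<Sum>i<n + m. f i) = (\<Sum>i<n. f i) + (\<Sum>i<m. f (n + i))"
  by (induction m) (auto simp: add.assoc)

section \<open>Moments of Toeplitz forms over roots of unity\<close>

lemma roots_of_unity_orthogonal:
  assumes "a < R" "b < R"
  defines "\<omega> \<equiv> \<lambda>r. cis (2 * pi * real r / real R)"
  shows "(\<Sum>r<R. \<omega> r ^ a * cnj (\<omega> r ^ b)) = (if a = b then of_nat R else 0)"
proof -
  define q where "q = cis (2 * pi * (real a - real b) / real R)"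
  have "\<omega> r ^ a * cnj (\<omega> r ^ b) = q ^ r" for r
    by (simp add: \<omega>_def q_def Complex.DeMoivre cis_cnj cis_mult algebra_simps diff_divide_distrib)
  then have sum_eq: "(\<Sum>r<R. \<omega> r ^ a * cnj (\<omega> r ^ b)) = (\<Sum>r<R. q ^ r)" by simp
  show ?thesis
  proof (cases "a = b")
    case True
    then show ?thesis unfolding sum_eq by (simp add: q_def)
  next
    case False
    have R: "R > 0" using assms by simp
    have "q ^ R = cis (2 * pi * of_int (int a - int b))"
    proof -
      have "real R * (2 * pi * (real a - real b) / real R) = 2 * pi * of_int (int a - int b)"
        using R by simp
      then show ?thesis by (simp only: q_def Complex.DeMoivre)
    qed
    then have "q ^ R = 1" by (metis cis_multiple_2pi Ints_of_int)
    \<comment> \<open>Otherwise \<open>a - b\<close> would be a nonzero multiple of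
      \<open>R\<close>, although both numbers lie below \<open>R\<close>.\<close>
    moreover have "q \<noteq> 1"
    proof
      assume "q = 1"
      then have "cos (2 * pi * (real a - real b) / real R) = 1"
        by (simp add: q_def complex_eq_iff)
      then obtain k where "2 * pi * (real a - real b) / real R = of_int k * 2 * pi"
        by (auto simp: cos_one_2pi_int)
      then have "(2 * pi) * ((real a - real b) / real R) = (2 * pi) * of_int k"
        by (simp add: mult_ac)
      then have "(real a - real b) / real R = of_int k"
        by (subst (asm) mult_cancel_left) simp
      then have "real_of_int (int a - int b) = real_of_int (k * int R)"
        using R by (simp add: divide_eq_eq)
      then have k: "int a - int b = k * int R" by linarith
      then have "k \<noteq> 0" using False by auto
      then have "1 * int R \<le> \<bar>k\<bar> * int R" by (intro mult_right_mono) auto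
      also have "\<dots> = \<bar>int a - int b\<bar>" using k by (simp add: abs_mult)
      finally show False using assms by linarith
    qed
    ultimately show ?thesis unfolding sum_eq by (simp add: geometric_sum False)
  qed
qed

text \<open>A finite form of Wiener's lemma. From \<open>0 \<le> s \<le> b\<close> the second moment
  of \<open>s\<close> over the sample points is at most \<open>b\<close> times the first. The first
  moment sees only the diagonal; the second sees every \<open>C i j\<close> once for each pair of
  the window with the same difference. The window is twice as long as the range \<open>n\<close> so
  that each entry of the \<open>n\<close> by \<open>n\<close> square is counted at least
  \<open>n\<close> times.\<close>

lemma Toeplitz_average_le:
  fixes C :: "nat \<Rightarrow> nat \<Rightarrow> complex" and s :: "complex \<Rightarrow> real"
  assumes shift: "\<And>i j t. C (i + t) (j + t) = C i j"
    and S: "\<And>z. cmod z = 1 \<Longrightarrow> (\<Sum>i<2*n. \<Sum>j<2*n. z ^ i * cnj (z ^ j) * C i j) = of_real (s z)"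
    and s: "\<And>z. cmod z = 1 \<Longrightarrow> 0 \<le> s z" "\<And>z. cmod z = 1 \<Longrightarrow> s z \<le> b"
  shows "real n * (\<Sum>i<n. \<Sum>j<n. (cmod (C i j))\<^sup>2) \<le> b * real (2 * n) * Re (C 0 0)"
proof (cases "n = 0")
  case False
  define N where "N = 2 * n"
  \<comment> \<open>In the second moment the exponents are sums of two indices below
    \<open>N\<close>; taking \<open>2 * N\<close> sample points keeps them below \<open>R\<close>,
    so distinct exponents are not confused.\<close>
  define R where "R = 2 * N"
  define \<omega> where "\<omega> = (\<lambda>r. cis (2 * pi * real r / real R))"
  define P where "P = {..<N} \<times> {..<N}"
  define a where "a = (\<lambda>r p. \<omega> r ^ fst p * cnj (\<omega> r ^ snd p) * C (fst p) (snd p))"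
  \<comment> \<open>The condition says that the pairs have equal differences, written additively
    because the indices are natural numbers.\<close>
  define c where "c = (\<lambda>p q. if fst p + snd q = snd p + fst q then (cmod (C (fst p) (snd p)))\<^sup>2 else 0)"
  have c0: "c p q \<ge> 0" for p q by (simp add: c_def)
  have cmod_\<omega>: "cmod (\<omega> r) = 1" for r by (simp add: \<omega>_def)
  have R: "R > 0" using False by (simp add: R_def N_def)
  have finP: "finite P" by (simp add: P_def)
  have orth: "(\<Sum>r<R. \<omega> r ^ a * cnj (\<omega> r ^ b)) = (if a = b then of_nat R else 0)" if "a < R" "b < R" for a b
    using roots_of_unity_orthogonal[OF that] by (simp add: \<omega>_def)
  have S': "of_real (s (\<omega> r)) = (\<Sum>p\<in>P. a r p)" for r
    unfolding S[OF cmod_\<omega>, symmetric] P_def a_def N_def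
    by (simp only: sum.cartesian_product case_prod_unfold)
  have Cii: "C i i = C 0 0" for i using shift[of 0 i 0] by simp
  \<comment> \<open>Shifting the first pair by \<open>l\<close> and the second by \<open>j\<close>
    makes them coincide.\<close>
  have C_eq: "C i j = C k l" if "i + l = j + k" for i j k l
  proof -
    have "C (i + l) (j + l) = C (k + j) (l + j)"
      by (rule arg_cong2[where f = C]) (use that in auto)
    then show ?thesis by (simp only: shift)
  qed
  have "complex_of_real (\<Sum>r<R. s (\<omega> r)) = (\<Sum>p\<in>P. \<Sum>r<R. a r p)"
    unfolding of_real_sum S' by (rule sum.swap)
  also have "\<dots> = (\<Sum>p\<in>P. if fst p = snd p then of_nat R * C 0 0 else 0)"
  proof (rule sum.cong[OF refl])
    fix p assume "p \<in> P"
    then have p: "fst p < R" "snd p < R" by (auto simp: P_def R_def)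
    have "(\<Sum>r<R. a r p) = (\<Sum>r<R. \<omega> r ^ fst p * cnj (\<omega> r ^ snd p)) * C (fst p) (snd p)"
      by (simp only: a_def sum_distrib_right)
    then show "(\<Sum>r<R. a r p) = (if fst p = snd p then of_nat R * C 0 0 else 0)"
      unfolding orth[OF p] by (auto simp: Cii[of "snd p"])
  qed
  also have "\<dots> = (\<Sum>i<N. \<Sum>j<N. if i = j then of_nat R * C 0 0 else 0)"
    by (simp only: P_def sum.cartesian_product case_prod_unfold)
  also have "\<dots> = complex_of_real (real R * real N) * C 0 0" by simp
  finally have "Re (complex_of_real (\<Sum>r<R. s (\<omega> r))) = Re (complex_of_real (real R * real N) * C 0 0)"
    by (rule arg_cong)
  then have first: "(\<Sum>r<R. s (\<omega> r)) = real R * real N * Re (C 0 0)"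
    by (simp only: Re_complex_of_real times_complex.sel Im_complex_of_real mult_zero_left diff_zero)
  \<comment> \<open>Parseval: in the square of \<open>s\<close>, written as \<open>s\<close> times
    its conjugate, the terms that survive summation over \<open>r\<close> pair entries on the same
    diagonal, which are equal by \<open>C_eq\<close>.\<close>
  have "complex_of_real (\<Sum>r<R. (s (\<omega> r))\<^sup>2) = (\<Sum>r<R. of_real (s (\<omega> r)) * cnj (of_real (s (\<omega> r))))"
    by (simp add: power2_eq_square)
  also have "\<dots> = (\<Sum>r<R. \<Sum>p\<in>P. \<Sum>q\<in>P. a r p * cnj (a r q))"
    by (simp only: S' cnj_sum sum_product)
  also have "\<dots> = (\<Sum>p\<in>P. \<Sum>r<R. \<Sum>q\<in>P. a r p * cnj (a r q))"
    by (rule sum.swap)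
  also have "\<dots> = (\<Sum>p\<in>P. \<Sum>q\<in>P. of_real (real R * c p q))"
  proof (rule sum.cong[OF refl])
    fix p assume p: "p \<in> P"
    have "(\<Sum>r<R. \<Sum>q\<in>P. a r p * cnj (a r q)) = (\<Sum>q\<in>P. \<Sum>r<R. a r p * cnj (a r q))"
      by (rule sum.swap)
    also have "\<dots> = (\<Sum>q\<in>P. of_real (real R * c p q))"
    proof (rule sum.cong[OF refl])
      fix q assume q: "q \<in> P"
      obtain i j k l where pq: "p = (i, j)" "q = (k, l)" by (metis surj_pair)
      have lt: "i + l < R" "j + k < R" using p q by (auto simp: P_def R_def pq)
      have "(\<Sum>r<R. a r p * cnj (a r q))
          = (\<Sum>r<R. \<omega> r ^ (i + l) * cnj (\<omega> r ^ (j + k)) * (C i j * cnj (C k l)))"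
        by (intro sum.cong refl) (simp add: a_def pq power_add)
      also have "\<dots> = (\<Sum>r<R. \<omega> r ^ (i + l) * cnj (\<omega> r ^ (j + k))) * (C i j * cnj (C k l))"
        by (simp only: sum_distrib_right)
      also have "\<dots> = of_real (real R * c p q)"
      proof (cases "i + l = j + k")
        case True
        then have "C i j * cnj (C k l) = of_real ((cmod (C i j))\<^sup>2)"
          using C_eq[OF True] by (simp only: complex_norm_square)
        with True show ?thesis unfolding orth[OF lt] by (simp add: c_def pq)
      next
        case False
        then show ?thesis unfolding orth[OF lt] by (simp add: c_def pq)
      qed
      finally show "(\<Sum>r<R. a r p * cnj (a r q)) = of_real (real R * c p q)" .
    qed
    finally show "(\<Sum>r<R. \<Sum>q\<in>P. a r p * cnj (a r q)) = (\<Sum>q\<in>P. of_real (real R * c p q))" .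
  qed
  also have "\<dots> = of_real (real R * (\<Sum>p\<in>P. \<Sum>q\<in>P. c p q))"
    by (simp only: of_real_sum sum_distrib_left)
  finally have second: "(\<Sum>r<R. (s (\<omega> r))\<^sup>2) = real R * (\<Sum>p\<in>P. \<Sum>q\<in>P. c p q)"
    by (simp only: of_real_eq_iff)
  \<comment> \<open>The \<open>n\<close> translates of \<open>p\<close> along its diagonal stay
    inside the window and each contributes the same value.\<close>
  have inner_le: "real n * (cmod (C (fst p) (snd p)))\<^sup>2 \<le> (\<Sum>q\<in>P. c p q)"
    if p: "p \<in> {..<n} \<times> {..<n}" for p
  proof -
    let ?h = "\<lambda>t. (fst p + t, snd p + t)"
    have "real n * (cmod (C (fst p) (snd p)))\<^sup>2 = (\<Sum>t<n. c p (?h t))"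
      by (simp add: c_def)
    also have "\<dots> = (\<Sum>q\<in>?h ` {..<n}. c p q)"
      by (subst sum.reindex) (auto simp: inj_on_def)
    also have "\<dots> \<le> (\<Sum>q\<in>P. c p q)"
      using p by (intro sum_mono2 finP c0) (auto simp: P_def N_def)
    finally show ?thesis .
  qed
  have "real n * (\<Sum>i<n. \<Sum>j<n. (cmod (C i j))\<^sup>2)
      = (\<Sum>p\<in>{..<n} \<times> {..<n}. real n * (cmod (C (fst p) (snd p)))\<^sup>2)"
    by (simp only: sum_distrib_left sum.cartesian_product case_prod_unfold)
  also have "\<dots> \<le> (\<Sum>p\<in>{..<n} \<times> {..<n}. \<Sum>q\<in>P. c p q)"
    by (intro sum_mono inner_le)
  also have "\<dots> \<le> (\<Sum>p\<in>P. \<Sum>q\<in>P. c p q)"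
    by (intro sum_mono2 finP sum_nonneg c0) (auto simp: P_def N_def)
  finally have lower: "real n * (\<Sum>i<n. \<Sum>j<n. (cmod (C i j))\<^sup>2) \<le> (\<Sum>p\<in>P. \<Sum>q\<in>P. c p q)" .
  have "real R * (\<Sum>p\<in>P. \<Sum>q\<in>P. c p q) \<le> (\<Sum>r<R. b * s (\<omega> r))"
    unfolding second[symmetric] using s[OF cmod_\<omega>]
    by (intro sum_mono) (simp add: power2_eq_square mult_right_mono)
  also have "\<dots> = b * (real R * real N * Re (C 0 0))"
    unfolding first[symmetric] by (rule sum_distrib_left[symmetric])
  also have "\<dots> = real R * (b * real N * Re (C 0 0))" by simp
  finally have "(\<Sum>p\<in>P. \<Sum>q\<in>P. c p q) \<le> b * real N * Re (C 0 0)"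
    using R by (simp only: mult_le_cancel_left_pos of_nat_0_less_iff)
  with lower show ?thesis by (simp add: N_def)
qed simp

section \<open>Measure-preserving maps and their action on L2\<close>

locale measure_preserving_map = prob_space M for M :: "'a measure" +
  fixes T :: "'a \<Rightarrow> 'a"
  assumes T_measurable [measurable]: "T \<in> measurable M M"
    and distr_T: "distr M M T = M"
begin

lemma funpow_measurable [measurable]: "(T ^^ n) \<in> measurable M M"
  by (rule measurable_compose_n) (rule T_measurable)

lemma distr_funpow: "distr M M (T ^^ n) = M"
proof (induction n)
  case (Suc n)
  have "distr M M (T ^^ Suc n) = distr (distr M M (T ^^ n)) M T"
    by (simp add: distr_distr)
  then show ?case by (simp only: Suc distr_T)
qed (simp add: distr_id2 id_def)

lemma integral_funpow:
  fixes f :: "'a \<Rightarrow> 'b::{banach, second_countable_topology}"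
  assumes "f \<in> borel_measurable M"
  shows "(\<integral>x. f ((T ^^ n) x) \<partial>M) = (\<integral>x. f x \<partial>M)"
  using integral_distr[OF funpow_measurable assms, of n] by (simp add: distr_funpow)

lemma integrable_funpow:
  fixes f :: "'a \<Rightarrow> 'b::{banach, second_countable_topology}"
  assumes "integrable M f"
  shows "integrable M (\<lambda>x. f ((T ^^ n) x))"
  by (rule integrable_distr[OF funpow_measurable]) (simp add: distr_funpow assms)

lemma AE_funpow:
  assumes "AE x in M. P x"
  shows "AE x in M. P ((T ^^ n) x)"
  using AE_distrD[OF funpow_measurable[of n], of P] assms by (simp only: distr_funpow)

lemma L2_space_funpow:
  assumes "f \<in> L2_space M"
  shows "(\<lambda>x. f ((T ^^ n) x)) \<in> L2_space M"
proof -
  note [measurable] = L2_space_measurable[OF assms]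
  have "integrable M (\<lambda>x. (cmod (f ((T ^^ n) x)))\<^sup>2)"
    using integrable_funpow[OF L2_space_integrable[OF assms]] .
  then show ?thesis by (simp add: L2_space_def)
qed

lemma L2_inner_funpow:
  assumes "f \<in> L2_space M" "g \<in> L2_space M"
  shows "L2_inner M (\<lambda>x. f ((T ^^ n) x)) (\<lambda>x. g ((T ^^ n) x)) = L2_inner M f g"
  unfolding L2_inner_def
  using integral_funpow[OF borel_measurable_integrable[OF integrable_L2_mult[OF assms]]] .

lemma L2_nrm_funpow:
  assumes "f \<in> L2_space M"
  shows "L2_nrm M (\<lambda>x. f ((T ^^ n) x)) = L2_nrm M f"
  unfolding L2_nrm_def
  using integral_funpow[OF borel_measurable_integrable[OF L2_space_integrable[OF assms]]] by simp

text \<open>Composition with \<open>T\<close> preserves the L2 norm, which is nonzero for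
  \<open>f\<close>.\<close>

lemma eigenvalue_cmod:
  assumes f: "f \<in> L2_space M" "\<not> (AE x in M. f x = 0)" and eig: "AE x in M. f (T x) = c * f x"
  shows "cmod c = 1"
proof -
  note [measurable] = L2_space_measurable[OF f(1)]
  have "L2_nrm M (\<lambda>x. f (T x)) = L2_nrm M (\<lambda>x. c * f x)"
    unfolding L2_nrm_def by (intro arg_cong[where f = sqrt] integral_cong_AE) (use eig in auto)
  then have "L2_nrm M f = cmod c * L2_nrm M f"
    using L2_nrm_funpow[OF f(1), of 1] by (simp add: L2_nrm_scale)
  moreover have "L2_nrm M f \<noteq> 0" using f L2_nrm_eq_0_iff by blast
  ultimately show ?thesis by simp
qed

text \<open>The quantifier over \<open>i\<close> stands inside \<open>AE\<close>, so one null set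
  serves the whole forward orbit.\<close>

lemma eigenfunction_funpow:
  fixes f :: "'a \<Rightarrow> complex"
  assumes eig: "AE x in M. f (T x) = c * f x"
  shows "AE x in M. \<forall>i. f ((T ^^ i) x) = c ^ i * f x"
  unfolding AE_all_countable
proof
  fix i
  show "AE x in M. f ((T ^^ i) x) = c ^ i * f x"
  proof (induction i)
    case (Suc i)
    from Suc AE_funpow[OF eig, of i] show ?case by eventually_elim (simp add: mult.assoc)
  qed simp
qed

section \<open>Twisted ergodic sums and correlations\<close>

definition twisted_sum :: "nat \<Rightarrow> complex \<Rightarrow> ('a \<Rightarrow> complex) \<Rightarrow> 'a \<Rightarrow> complex" where
  "twisted_sum n z g = (\<lambda>x. \<Sum>i<n. z ^ i * g ((T ^^ i) x))"

lemma twisted_sum_L2: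
  assumes "g \<in> L2_space M"
  shows "twisted_sum n z g \<in> L2_space M"
  unfolding twisted_sum_def by (intro L2_space_sum L2_space_scale L2_space_funpow assms)

lemma twisted_sum_nrm_le:
  assumes "g \<in> L2_space M" "cmod z = 1"
  shows "L2_nrm M (twisted_sum n z g) \<le> real n * L2_nrm M g"
proof -
  have "L2_nrm M (twisted_sum n z g) \<le> (\<Sum>i<n. L2_nrm M (\<lambda>x. z ^ i * g ((T ^^ i) x)))"
    unfolding twisted_sum_def by (intro L2_nrm_sum L2_space_scale L2_space_funpow assms)
  also have "\<dots> = real n * L2_nrm M g"
    by (simp add: L2_nrm_scale L2_nrm_funpow assms norm_power)
  finally show ?thesis .
qed

text \<open>The second half of the sum is the first half composed with \<open>T ^^ n\<close> and
  multiplied by \<open>z ^ n\<close>, hence of equal norm. Divided by the lengths, this makes the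
  averages decrease under doubling, which fails for general increments of \<open>n\<close>.\<close>

lemma twisted_sum_double:
  assumes "g \<in> L2_space M" "cmod z = 1"
  shows "L2_nrm M (twisted_sum (2 * n) z g) \<le> 2 * L2_nrm M (twisted_sum n z g)"
proof -
  have "twisted_sum (2 * n) z g = (\<lambda>x. twisted_sum n z g x + z ^ n * twisted_sum n z g ((T ^^ n) x))"
  proof
    fix x
    have "(T ^^ (n + i)) x = (T ^^ i) ((T ^^ n) x)" for i
      by (metis add.commute comp_apply funpow_add)
    then show "twisted_sum (2 * n) z g x = twisted_sum n z g x + z ^ n * twisted_sum n z g ((T ^^ n) x)"
      unfolding twisted_sum_def mult_2 sum_lessThan_add
      by (simp add: sum_distrib_left power_add mult.assoc)
  qed
  then have "L2_nrm M (twisted_sum (2 * n) z g) \<le> L2_nrm M (twisted_sum n z g)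
      + L2_nrm M (\<lambda>x. z ^ n * twisted_sum n z g ((T ^^ n) x))"
    using L2_nrm_triangle[OF twisted_sum_L2[OF assms(1)]
        L2_space_scale[OF L2_space_funpow[OF twisted_sum_L2[OF assms(1)]]]]
    by (simp only:)
  then show ?thesis
    by (simp add: L2_nrm_scale L2_nrm_funpow twisted_sum_L2 assms norm_power)
qed

definition correlation :: "('a \<Rightarrow> complex) \<Rightarrow> nat \<Rightarrow> nat \<Rightarrow> complex" where
  "correlation g i j = L2_inner M (\<lambda>x. g ((T ^^ i) x)) (\<lambda>x. g ((T ^^ j) x))"

lemma correlation_shift:
  assumes "g \<in> L2_space M"
  shows "correlation g (i + t) (j + t) = correlation g i j"
proof -
  have "(T ^^ (k + t)) x = (T ^^ k) ((T ^^ t) x)" for k x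
    by (simp add: funpow_add)
  then show ?thesis
    unfolding correlation_def
    using L2_inner_funpow[OF L2_space_funpow[OF assms, of i] L2_space_funpow[OF assms, of j], of t]
    by simp
qed

lemma L2_nrm_combination:
  assumes "g \<in> L2_space M"
  shows "of_real ((L2_nrm M (\<lambda>x. \<Sum>i<n. b i * g ((T ^^ i) x)))\<^sup>2)
    = (\<Sum>i<n. \<Sum>j<n. b i * cnj (b j) * correlation g i j)"
proof -
  have L2: "(\<lambda>x. b i * g ((T ^^ i) x)) \<in> L2_space M" for i
    by (intro L2_space_scale L2_space_funpow assms)
  show ?thesis
    unfolding L2_inner_self[symmetric]
    by (simp add: L2_inner_sum_left L2_inner_sum_right L2 L2_space_sum L2_inner_scale_left
        L2_inner_scale_right L2_space_funpow assms correlation_def sum_distrib_left mult_ac)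
qed

text \<open>Twisted coboundaries \<open>v - z * v o T\<close> have bounded twisted sums. A function
  outside their closure pairs nontrivially with some \<open>h\<close> orthogonal to all of them, and
  such an \<open>h\<close> is an eigenfunction with eigenvalue \<open>cnj z\<close>.\<close>

lemma mean_ergodic_twisted:
  assumes g: "g \<in> L2_space M" and z: "cmod z = 1"
    and orth: "\<And>e. eigenfunction M T e \<Longrightarrow> L2_inner M g e = 0"
  shows "(\<lambda>n. L2_nrm M (twisted_sum n z g) / real n) \<longlonglongrightarrow> 0"
proof -
  define W where "W = (\<lambda>v x. v x - z * v (T x)) ` L2_space M"
  have L2_T: "(\<lambda>x. v (T x)) \<in> L2_space M" if "v \<in> L2_space M" for v
    using L2_space_funpow[OF that, of 1] by simp
  have L2_W: "(\<lambda>x. v x - z * v (T x)) \<in> L2_space M" if "v \<in> L2_space M" for v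
    by (intro L2_space_diff L2_space_scale L2_T that)
  have g_closure: "g \<in> L2_closure M W"
  proof (rule ccontr)
    assume "g \<notin> L2_closure M W"
    moreover have "(\<lambda>x. u x + c * v x) \<in> W" if "u \<in> W" "v \<in> W" for u v c
    proof -
      obtain u' v' where uv: "u' \<in> L2_space M" "v' \<in> L2_space M"
        "u = (\<lambda>x. u' x - z * u' (T x))" "v = (\<lambda>x. v' x - z * v' (T x))"
        using \<open>u \<in> W\<close> \<open>v \<in> W\<close> by (auto simp: W_def)
      have "(\<lambda>x. u x + c * v x) = (\<lambda>x. (u' x + c * v' x) - z * (u' (T x) + c * v' (T x)))"
        by (simp add: uv algebra_simps)
      then show ?thesis
        unfolding W_def using L2_space_add[OF uv(1) L2_space_scale[OF uv(2), of c]] by (rule image_eqI)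
    qed
    moreover have "W \<subseteq> L2_space M" "W \<noteq> {}"
      using L2_W L2_space_zero by (auto simp: W_def)
    ultimately obtain h where h: "h \<in> L2_space M" and orth_W: "\<forall>v\<in>W. L2_inner M v h = 0"
      and gh: "L2_inner M g h \<noteq> 0"
      using L2_projection[OF g, of W] by metis
    define h' where "h' = (\<lambda>x. z * h (T x))"
    have h': "h' \<in> L2_space M" unfolding h'_def by (intro L2_space_scale L2_T h)
    have nrm_h': "L2_nrm M h' = L2_nrm M h"
      unfolding h'_def using L2_nrm_funpow[OF h, of 1] by (simp add: L2_nrm_scale z)
    have "L2_inner M (\<lambda>x. h x - h' x) h = 0"
      using orth_W h by (auto simp: W_def h'_def)
    then have "L2_inner M h' h = of_real ((L2_nrm M h)\<^sup>2)"
      using L2_inner_diff_left[OF h h' h] by (simp add: L2_inner_self)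
    then have "L2_inner M h h' = of_real ((L2_nrm M h)\<^sup>2)"
      using L2_inner_cnj[of M h' h] by simp
    \<comment> \<open>\<open>h\<close> and \<open>h'\<close> have equal norms and their inner
      product is the square of that norm, so this is the equality case of Cauchy-Schwarz.\<close>
    then have "(L2_nrm M (\<lambda>x. h x - h' x))\<^sup>2 = 0"
      unfolding L2_nrm_diff_power2[OF h h'] nrm_h' by simp
    then have "AE x in M. h x - h' x = 0"
      using L2_nrm_eq_0_iff[OF L2_space_diff[OF h h']] by simp
    then have "AE x in M. h (T x) = cnj z * h x"
    proof eventually_elim
      case (elim x)
      then have "cnj z * h x = (z * cnj z) * h (T x)" by (simp add: h'_def)
      also have "z * cnj z = 1" using z by (metis complex_norm_square of_real_1 power_one)
      finally show ?case by simp
    qed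
    moreover have "\<not> (AE x in M. h x = 0)"
    proof
      assume "AE x in M. h x = 0"
      then have "L2_nrm M h = 0" using L2_nrm_eq_0_iff[OF h] by simp
      then show False using L2_Cauchy_Schwarz[OF g h] gh by simp
    qed
    ultimately have "eigenfunction M T h" using h by (auto simp: eigenfunction_def)
    then show False using orth gh by blast
  qed
  show ?thesis
  proof (rule LIMSEQ_I)
    fix e :: real assume e: "e > 0"
    have "\<forall>\<epsilon>>0. \<exists>w\<in>W. L2_dist M g w < \<epsilon>"
      using g_closure by (simp add: L2_closure_def)
    then obtain w where "w \<in> W" and gw: "L2_dist M g w < e / 2"
      using e half_gt_zero by blast
    then obtain v where v: "v \<in> L2_space M" and w: "w = (\<lambda>x. v x - z * v (T x))"
      by (auto simp: W_def)
    have wL2: "w \<in> L2_space M" unfolding w by (rule L2_W[OF v])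
    \<comment> \<open>The twisted sum of a coboundary telescopes; its norm is at most twice that of
      \<open>v\<close>, whatever \<open>n\<close> is.\<close>
    have tw: "twisted_sum n z w = (\<lambda>x. v x - z ^ n * v ((T ^^ n) x))" for n
    proof
      fix x
      show "twisted_sum n z w x = v x - z ^ n * v ((T ^^ n) x)"
        by (induction n) (auto simp: twisted_sum_def w algebra_simps)
    qed
    have bound: "L2_nrm M (twisted_sum n z g) \<le> real n * (e / 2) + 2 * L2_nrm M v" for n
    proof -
      have "twisted_sum n z g = (\<lambda>x. twisted_sum n z (\<lambda>x. g x - w x) x + twisted_sum n z w x)"
        by (simp add: twisted_sum_def right_diff_distrib sum_subtractf)
      then have "L2_nrm M (twisted_sum n z g)
          \<le> L2_nrm M (twisted_sum n z (\<lambda>x. g x - w x)) + L2_nrm M (twisted_sum n z w)"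
        using L2_nrm_triangle[OF twisted_sum_L2[OF L2_space_diff[OF g wL2]] twisted_sum_L2[OF wL2]]
        by (simp only:)
      also have "L2_nrm M (twisted_sum n z (\<lambda>x. g x - w x)) \<le> real n * L2_nrm M (\<lambda>x. g x - w x)"
        by (rule twisted_sum_nrm_le[OF L2_space_diff[OF g wL2] z])
      also have "\<dots> \<le> real n * (e / 2)"
        using gw by (intro mult_left_mono) (auto simp: L2_dist_eq_nrm)
      also have "L2_nrm M (twisted_sum n z w) \<le> L2_nrm M v + L2_nrm M (\<lambda>x. z ^ n * v ((T ^^ n) x))"
        using L2_nrm_triangle[OF v L2_space_scale[OF L2_space_funpow[OF v, of n], of "- (z ^ n)"]]
          L2_nrm_scale[of M "- (z ^ n)"] L2_nrm_scale[of M "z ^ n"]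
        by (simp add: tw)
      also have "\<dots> = 2 * L2_nrm M v"
        by (simp add: L2_nrm_scale L2_nrm_funpow v norm_power z)
      finally show ?thesis by simp
    qed
    obtain n0 where n0: "4 * L2_nrm M v / e < real n0" using reals_Archimedean2 by blast
    have "norm (L2_nrm M (twisted_sum n z g) / real n - 0) < e" if "n \<ge> Suc n0" for n
    proof -
      have "4 * L2_nrm M v / e < real n" using n0 that by linarith
      then have "2 * L2_nrm M v < real n * (e / 2)" using e by (simp add: field_simps)
      with bound[of n] have "L2_nrm M (twisted_sum n z g) < real n * e" by simp
      then show ?thesis using that by (simp add: field_simps)
    qed
    then show "\<exists>n0. \<forall>n\<ge>n0. norm (L2_nrm M (twisted_sum n z g) / real n - 0) < e" by blast
  qed
qed

text \<open>Along powers of two the averages are decreasing, so the convergence is uniform in \<open>z\<close>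
  by compactness of the circle (Dini).\<close>

lemma twisted_sum_uniform:
  assumes g: "g \<in> L2_space M"
    and orth: "\<And>e. eigenfunction M T e \<Longrightarrow> L2_inner M g e = 0"
    and e: "e > 0"
  shows "\<exists>k0. \<forall>k\<ge>k0. \<forall>z. cmod z = 1 \<longrightarrow> L2_nrm M (twisted_sum (2 ^ k) z g) \<le> e * 2 ^ k"
proof (rule ccontr)
  assume neg: "\<not> ?thesis"
  define q where "q = (\<lambda>k z. L2_nrm M (twisted_sum (2 ^ k) z g) / 2 ^ k)"
  define F where "F = (\<lambda>k. {z. cmod z = 1 \<and> e \<le> q k z})"
  have q_Suc: "q (Suc k) z \<le> q k z" if "cmod z = 1" for k z
    using twisted_sum_double[OF g that, of "2 ^ k"] by (simp add: q_def field_simps)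
  have q_mono: "q k z \<le> q m z" if "cmod z = 1" "m \<le> k" for k m z
    using \<open>m \<le> k\<close> by (rule lift_Suc_antimono_le[of "\<lambda>k. q k z", rotated]) (rule q_Suc[OF that(1)])
  have "\<Inter>(range F) \<noteq> {}"
  proof (rule compact_nest)
    show "F k \<subseteq> F m" if "m \<le> k" for m k
      using q_mono that by (fastforce simp: F_def)
    show "F m \<noteq> {}" for m
    proof -
      from neg obtain k z where k: "k \<ge> m" and z: "cmod z = 1"
        and "\<not> L2_nrm M (twisted_sum (2 ^ k) z g) \<le> e * 2 ^ k" by blast
      then have "e \<le> q k z" by (simp add: q_def field_simps)
      also have "\<dots> \<le> q m z" by (rule q_mono[OF z k])
      finally show ?thesis using z by (auto simp: F_def)
    qed
    show "compact (F k)" for k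
    proof -
      \<comment> \<open>Expanding the norm into a finite sum in \<open>z\<close> and
        \<open>cnj z\<close> with constant coefficients makes its continuity in \<open>z\<close>
        evident.\<close>
      have nrm_eq: "(L2_nrm M (twisted_sum (2 ^ k) z g))\<^sup>2
          = Re (\<Sum>i<2 ^ k. \<Sum>j<2 ^ k. z ^ i * cnj (z ^ j) * correlation g i j)" for z
        unfolding twisted_sum_def L2_nrm_combination[OF g, symmetric] by simp
      have "e \<le> q k z \<longleftrightarrow> (e * 2 ^ k)\<^sup>2 \<le> (L2_nrm M (twisted_sum (2 ^ k) z g))\<^sup>2" for z
        using power_mono_iff[of "e * 2 ^ k" "L2_nrm M (twisted_sum (2 ^ k) z g)" 2] e
        by (simp add: q_def pos_le_divide_eq)
      then have "F k = sphere 0 1 \<inter> {z. (e * 2 ^ k)\<^sup>2 \<le> (L2_nrm M (twisted_sum (2 ^ k) z g))\<^sup>2}"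
        by (auto simp: F_def)
      moreover have "closed {z. (e * 2 ^ k)\<^sup>2 \<le> (L2_nrm M (twisted_sum (2 ^ k) z g))\<^sup>2}"
        unfolding nrm_eq by (intro closed_Collect_le continuous_intros)
      ultimately show ?thesis by (metis compact_sphere compact_Int_closed)
    qed
  qed
  \<comment> \<open>At a common point of all the \<open>F k\<close> the averages never drop below
    \<open>e\<close>, against the pointwise convergence.\<close>
  then obtain z where z: "cmod z = 1" and "\<And>k. e \<le> q k z" by (auto simp: F_def)
  moreover have "(\<lambda>k. q k z) \<longlonglongrightarrow> 0"
  proof -
    have "filterlim (\<lambda>k. 2 ^ k :: nat) sequentially sequentially"
      by (rule filterlim_subseq) (simp add: strict_mono_def)
    from filterlim_compose[OF mean_ergodic_twisted[OF g z orth] this]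
    show ?thesis by (simp add: q_def)
  qed
  ultimately have "e \<le> 0" by (intro LIMSEQ_le_const) auto
  with e show False by simp
qed

lemma correlation_average:
  assumes g: "g \<in> L2_space M"
    and orth: "\<And>e. eigenfunction M T e \<Longrightarrow> L2_inner M g e = 0"
    and e: "e > 0"
  shows "\<exists>n>0. (\<Sum>i<n. \<Sum>j<n. (cmod (correlation g i j))\<^sup>2) \<le> (e * real n)\<^sup>2"
proof -
  \<comment> \<open>The Toeplitz bound yields the factor
    \<open>8 * (d * L2_nrm M g)\<^sup>2\<close>; the 4 makes it at most half of the square of
    \<open>e\<close>, and the \<open>+ 1\<close> covers a \<open>g\<close> of norm zero.\<close>
  define d where "d = e / (4 * (L2_nrm M g + 1))"
  have d: "d > 0" using e by (simp add: d_def add_nonneg_pos)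
  obtain k0 where k0: "\<And>k z. k \<ge> k0 \<Longrightarrow> cmod z = 1 \<Longrightarrow> L2_nrm M (twisted_sum (2 ^ k) z g) \<le> d * 2 ^ k"
    using twisted_sum_uniform[OF g orth d] by blast
  define n :: nat where "n = 2 ^ k0"
  have n: "n > 0" by (simp add: n_def)
  define s where "s = (\<lambda>z. (L2_nrm M (twisted_sum (2 * n) z g))\<^sup>2)"
  let ?Q = "\<Sum>i<n. \<Sum>j<n. (cmod (correlation g i j))\<^sup>2"
  have "real n * ?Q \<le> (d * real (2 * n))\<^sup>2 * real (2 * n) * Re (correlation g 0 0)"
  proof (rule Toeplitz_average_le)
    show "(\<Sum>i<2*n. \<Sum>j<2*n. z ^ i * cnj (z ^ j) * correlation g i j) = of_real (s z)" for z
      unfolding s_def twisted_sum_def L2_nrm_combination[OF g] ..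
    \<comment> \<open>The window \<open>2 * n\<close> is \<open>2 ^ Suc k0\<close>, again a power of
      two beyond the threshold.\<close>
    show "s z \<le> (d * real (2 * n))\<^sup>2" if "cmod z = 1" for z
      unfolding s_def using k0[of "Suc k0" z] that by (intro power_mono) (auto simp: n_def)
  qed (simp_all add: s_def correlation_shift g)
  also have "Re (correlation g 0 0) = (L2_nrm M g)\<^sup>2"
    by (simp add: correlation_def L2_inner_self)
  also have "(d * real (2 * n))\<^sup>2 * real (2 * n) * (L2_nrm M g)\<^sup>2 = real n * (8 * (d * L2_nrm M g)\<^sup>2 * (real n)\<^sup>2)"
    by (simp add: power2_eq_square)
  finally have "?Q \<le> 8 * (d * L2_nrm M g)\<^sup>2 * (real n)\<^sup>2"
    using n by (simp only: mult_le_cancel_left_pos of_nat_0_less_iff)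
  also have "\<dots> \<le> 8 * (e / 4)\<^sup>2 * (real n)\<^sup>2"
  proof -
    have pos: "L2_nrm M g + 1 > 0" by (simp add: add_nonneg_pos)
    have "d * L2_nrm M g = e / 4 * (L2_nrm M g / (L2_nrm M g + 1))" by (simp add: d_def)
    also have "\<dots> \<le> e / 4 * 1"
      using e pos by (intro mult_left_mono) (auto simp: divide_le_eq_1)
    finally have "d * L2_nrm M g \<le> e / 4" by simp
    then show ?thesis using d by (intro mult_right_mono mult_left_mono power_mono) auto
  qed
  also have "\<dots> \<le> (e * real n)\<^sup>2" by (simp add: power_mult_distrib power_divide)
  finally show ?thesis using n by blast
qed

text \<open>A Bessel inequality for a family that is not orthogonal: the square root on the right is
  the Hilbert-Schmidt norm of the Gram matrix, which dominates its operator norm.\<close>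

lemma sum_inner_orbit_le:
  assumes g: "g \<in> L2_space M" and w: "w \<in> L2_space M"
  shows "(\<Sum>i<n. (cmod (L2_inner M w (\<lambda>x. g ((T ^^ i) x))))\<^sup>2)
    \<le> (L2_nrm M w)\<^sup>2 * sqrt (\<Sum>i<n. \<Sum>j<n. (cmod (correlation g i j))\<^sup>2)"
proof -
  define b where "b = (\<lambda>i. L2_inner M w (\<lambda>x. g ((T ^^ i) x)))"
  define X where "X = (\<Sum>i<n. (cmod (b i))\<^sup>2)"
  define Q where "Q = (\<Sum>i<n. \<Sum>j<n. (cmod (correlation g i j))\<^sup>2)"
  \<comment> \<open>With these coefficients the inner product of \<open>w\<close> and
    \<open>u\<close> is exactly \<open>X\<close>, while the squared norm of \<open>u\<close> is at
    most \<open>X * sqrt Q\<close>; Cauchy-Schwarz then leaves one factor \<open>X\<close> to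
    cancel.\<close>
  define u where "u = (\<lambda>x. \<Sum>i<n. b i * g ((T ^^ i) x))"
  have L2: "(\<lambda>x. b i * g ((T ^^ i) x)) \<in> L2_space M" for i
    by (intro L2_space_scale L2_space_funpow g)
  have u: "u \<in> L2_space M" unfolding u_def by (intro L2_space_sum L2)
  have X0: "X \<ge> 0" unfolding X_def by (intro sum_nonneg) simp
  have "L2_inner M w (\<lambda>x. b i * g ((T ^^ i) x)) = b i * cnj (b i)" for i
    by (simp add: L2_inner_scale_right b_def)
  then have "L2_inner M w u = (\<Sum>i<n. b i * cnj (b i))"
    unfolding u_def by (simp add: L2_inner_sum_right L2 w)
  also have "\<dots> = of_real X" by (simp only: X_def of_real_sum complex_norm_square)
  finally have "X \<le> L2_nrm M w * L2_nrm M u"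
    using L2_Cauchy_Schwarz[OF w u] X0 by simp
  then have "X\<^sup>2 \<le> (L2_nrm M w)\<^sup>2 * (L2_nrm M u)\<^sup>2"
    using power_mono[OF _ X0, of "L2_nrm M w * L2_nrm M u" 2] by (simp add: power_mult_distrib)
  also have "(L2_nrm M u)\<^sup>2 \<le> X * sqrt Q"
  proof -
    let ?P = "{..<n} \<times> {..<n}"
    have "(L2_nrm M u)\<^sup>2 = cmod (of_real ((L2_nrm M u)\<^sup>2))" by (simp only: norm_of_real abs_power2)
    also have "\<dots> = cmod (\<Sum>i<n. \<Sum>j<n. b i * cnj (b j) * correlation g i j)"
      unfolding u_def L2_nrm_combination[OF g] ..
    also have "\<dots> = cmod (\<Sum>(i, j)\<in>?P. b i * cnj (b j) * correlation g i j)"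
      by (simp add: sum.cartesian_product)
    also have "\<dots> \<le> (\<Sum>p\<in>?P. (cmod (b (fst p)) * cmod (b (snd p))) * cmod (correlation g (fst p) (snd p)))"
      by (rule order_trans[OF norm_sum]) (simp add: case_prod_unfold norm_mult)
    also have "\<dots> \<le> sqrt ((\<Sum>p\<in>?P. (cmod (b (fst p)) * cmod (b (snd p)))\<^sup>2)
        * (\<Sum>p\<in>?P. (cmod (correlation g (fst p) (snd p)))\<^sup>2))"
      by (rule real_le_rsqrt) (rule Cauchy_Schwarz_ineq_sum)
    also have "(\<Sum>p\<in>?P. (cmod (b (fst p)) * cmod (b (snd p)))\<^sup>2) = X\<^sup>2"
      by (simp add: X_def power2_eq_square[of "sum _ _"] sum_product sum.cartesian_product
          power_mult_distrib case_prod_unfold)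
    also have "(\<Sum>p\<in>?P. (cmod (correlation g (fst p) (snd p)))\<^sup>2) = Q"
      by (simp add: Q_def sum.cartesian_product case_prod_unfold)
    also have "sqrt (X\<^sup>2 * Q) = X * sqrt Q" using X0 by (simp add: real_sqrt_mult)
    finally show ?thesis .
  qed
  then have "(L2_nrm M w)\<^sup>2 * (L2_nrm M u)\<^sup>2 \<le> (L2_nrm M w)\<^sup>2 * (X * sqrt Q)"
    by (intro mult_left_mono) auto
  finally have "X * X \<le> X * ((L2_nrm M w)\<^sup>2 * sqrt Q)"
    by (simp only: power2_eq_square mult_ac)
  moreover have "Q \<ge> 0" unfolding Q_def by (intro sum_nonneg) simp
  ultimately have "X \<le> (L2_nrm M w)\<^sup>2 * sqrt Q"
    using X0 by (cases "X = 0") (auto simp: mult_le_cancel_left)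
  then show ?thesis by (simp add: X_def Q_def b_def)
qed

text \<open>One \<open>n\<close> serves every \<open>w\<close>. This order of quantifiers is
  essential: the functions \<open>w\<close> to be inserted are indicators of sets cut out of Hamming
  balls of length \<open>n\<close>.\<close>

lemma weak_mixing_average:
  assumes g: "g \<in> L2_space M"
    and orth: "\<And>e. eigenfunction M T e \<Longrightarrow> L2_inner M g e = 0"
    and e: "e > 0"
  shows "\<exists>n>0. \<forall>w\<in>L2_space M.
    (\<Sum>i<n. (cmod (L2_inner M w (\<lambda>x. g ((T ^^ i) x))))\<^sup>2) \<le> e * real n * (L2_nrm M w)\<^sup>2"
proof -
  obtain n where n: "n > 0" and Q: "(\<Sum>i<n. \<Sum>j<n. (cmod (correlation g i j))\<^sup>2) \<le> (e * real n)\<^sup>2"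
    using correlation_average[OF g orth e] by blast
  have "(\<Sum>i<n. (cmod (L2_inner M w (\<lambda>x. g ((T ^^ i) x))))\<^sup>2) \<le> e * real n * (L2_nrm M w)\<^sup>2"
    if w: "w \<in> L2_space M" for w
  proof -
    have "sqrt (\<Sum>i<n. \<Sum>j<n. (cmod (correlation g i j))\<^sup>2) \<le> e * real n"
      using real_sqrt_le_mono[OF Q] e by simp
    from mult_left_mono[OF this, of "(L2_nrm M w)\<^sup>2"] sum_inner_orbit_le[OF g w, of n]
    show ?thesis by (simp add: mult.commute)
  qed
  with n show ?thesis by blast
qed

end

section \<open>Bounded complexity implies discrete spectrum\<close>

lemma complex_span_L2:
  assumes "E \<subseteq> L2_space M"
  shows "complex_span E \<subseteq> L2_space M"
proof
  fix u assume "u \<in> complex_span E"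
  then obtain F c where "finite F" "F \<subseteq> E" and u: "u = (\<lambda>x. \<Sum>f\<in>F. c f * f x)"
    by (auto simp: complex_span_def)
  then show "u \<in> L2_space M"
    unfolding u using assms by (intro L2_space_sum L2_space_scale) auto
qed

lemma complex_span_base:
  assumes "e \<in> E"
  shows "e \<in> complex_span E"
  unfolding complex_span_def
  by (rule CollectI, intro exI[of _ "{e}"] exI[of _ "\<lambda>_. 1"]) (use assms in auto)

lemma complex_span_lin:
  assumes "u \<in> complex_span E" "v \<in> complex_span E"
  shows "(\<lambda>x. u x + a * v x) \<in> complex_span E"
proof -
  obtain F c where F: "finite F" "F \<subseteq> E" and u: "u = (\<lambda>x. \<Sum>f\<in>F. c f * f x)"
    using assms(1) by (auto simp: complex_span_def)
  obtain G d where G: "finite G" "G \<subseteq> E" and v: "v = (\<lambda>x. \<Sum>f\<in>G. d f * f x)"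
    using assms(2) by (auto simp: complex_span_def)
  define b where "b = (\<lambda>f. (if f \<in> F then c f else 0) + a * (if f \<in> G then d f else 0))"
  have "u x + a * v x = (\<Sum>f\<in>F \<union> G. b f * f x)" for x
  proof -
    have "u x = (\<Sum>f\<in>F \<union> G. (if f \<in> F then c f else 0) * f x)"
      unfolding u using F G by (intro sum.mono_neutral_cong_left) auto
    moreover have "v x = (\<Sum>f\<in>F \<union> G. (if f \<in> G then d f else 0) * f x)"
      unfolding v using F G by (intro sum.mono_neutral_cong_left) auto
    ultimately show ?thesis
      by (simp add: b_def distrib_right sum.distrib sum_distrib_left mult.assoc)
  qed
  then have "(\<lambda>x. u x + a * v x) = (\<lambda>x. \<Sum>f\<in>F \<union> G. b f * f x)" by blast
  then show ?thesis
    unfolding complex_span_def using F G by blast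
qed

context measure_preserving_map
begin

lemma funpow_space: "x \<in> space M \<Longrightarrow> (T ^^ i) x \<in> space M"
  using measurable_space[OF funpow_measurable] .

lemma indicator_L2: "A \<in> sets M \<Longrightarrow> (indicator A :: 'a \<Rightarrow> complex) \<in> L2_space M"
proof -
  assume A: "A \<in> sets M"
  have "(\<lambda>x. (cmod (indicator A x))\<^sup>2) = indicator A"
    by (auto simp: indicator_def)
  moreover have "integrable M (indicator A :: 'a \<Rightarrow> real)"
    using A by (simp add: integrable_indicator_iff emeasure_eq_measure)
  ultimately show ?thesis using A by (simp add: L2_space_def)
qed

lemma indicator_nrm_le_1:
  assumes "A \<in> sets M"
  shows "L2_nrm M (indicator A) \<le> 1"
proof -
  have "(\<lambda>x. (cmod (indicator A x))\<^sup>2) = indicator A"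
    by (auto simp: indicator_def)
  then have "L2_nrm M (indicator A) = sqrt (measure M A)"
    using assms sets.sets_into_space[OF assms] by (simp add: L2_nrm_def Int_absorb2)
  then show ?thesis by simp
qed

end

section \<open>Orbit names and Hamming balls of a partition\<close>

locale partitioned_map = measure_preserving_map +
  fixes l :: nat and A :: "nat \<Rightarrow> 'a set"
  assumes partition: "finite_measurable_partition M l A"
begin

lemma cell_sets [measurable]: "h \<in> {1..l} \<Longrightarrow> A h \<in> sets M"
  using partition by (auto simp: finite_measurable_partition_def)

lemma cell_ex1:
  assumes "x \<in> space M"
  shows "\<exists>!h. h \<in> {1..l} \<and> x \<in> A h"
proof -
  have inj: "inj_on A {1..l}" and part: "partition_on (space M) (A ` {1..l})"
    using partition by (simp_all only: finite_measurable_partition_def)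
  have "x \<in> \<Union>(A ` {1..l})"
    using partition_onD1[OF part] assms by simp
  then obtain h where h: "h \<in> {1..l}" "x \<in> A h" by blast
  have uniq: "k = h" if "k \<in> {1..l}" "x \<in> A k" for k
  proof (rule ccontr)
    assume "k \<noteq> h"
    then have "A k \<noteq> A h"
      using inj_on_eq_iff[OF inj that(1) h(1)] by simp
    then have "A k \<inter> A h = {}"
      by (rule disjointD[OF partition_onD2[OF part] imageI[OF that(1)] imageI[OF h(1)]])
    then show False using IntI[OF that(2) h(2)] by simp
  qed
  show ?thesis
  proof (rule ex1I[of _ h])
    show "h \<in> {1..l} \<and> x \<in> A h" using h by (rule conjI)
    show "k = h" if "k \<in> {1..l} \<and> x \<in> A k" for k
      using uniq[OF conjunct1[OF that] conjunct2[OF that]] .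
  qed
qed

lemma cell_index_iff:
  assumes "x \<in> space M"
  shows "cell_index T l A i x = h \<longleftrightarrow> h \<in> {1..l} \<and> (T ^^ i) x \<in> A h"
proof
  note ex1 = cell_ex1[OF funpow_space[OF assms, of i]]
  show "h \<in> {1..l} \<and> (T ^^ i) x \<in> A h" if "cell_index T l A i x = h"
    using theI'[OF ex1] unfolding that[symmetric] cell_index_def .
  show "cell_index T l A i x = h" if "h \<in> {1..l} \<and> (T ^^ i) x \<in> A h"
    unfolding cell_index_def using ex1 that by (rule the1_equality)
qed

lemma cell_index_measurable [measurable]:
  "cell_index T l A i \<in> measurable M (count_space UNIV)"
proof -
  have "cell_index T l A i -` {h} \<inter> space M = (if h \<in> {1..l} then (T ^^ i) -` A h \<inter> space M else {})" for h
    using cell_index_iff by auto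
  moreover have "(T ^^ i) -` A h \<inter> space M \<in> sets M" if "h \<in> {1..l}" for h
    using measurable_sets[OF funpow_measurable cell_sets[OF that]] .
  ultimately show ?thesis
    by (subst measurable_count_space_eq_countable) auto
qed

text \<open>In this form measurability rules and termwise estimates apply.\<close>

lemma hamming_dist_eq_sum:
  "hamming_dist T l A n x y = (\<Sum>i<n. of_bool (cell_index T l A i x \<noteq> cell_index T l A i y)) / real n"
proof -
  have "{i. i < n \<and> cell_index T l A i x \<noteq> cell_index T l A i y}
      = {..<n} \<inter> {i. cell_index T l A i x \<noteq> cell_index T l A i y}" by auto
  then show ?thesis by (simp add: hamming_dist_def)
qed

lemma hamming_ball_sets [measurable]: "hamming_ball M T l A n x \<epsilon> \<in> sets M"
  unfolding hamming_ball_def hamming_dist_eq_sum by measurable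

lemma hamming_cover:
  assumes "\<epsilon> > 0"
  shows "\<exists>F. finite F \<and> F \<subseteq> space M \<and> measure M (\<Union>x\<in>F. hamming_ball M T l A n x \<epsilon>) > 1 - \<epsilon>"
proof -
  define name where "name = (\<lambda>x. restrict (\<lambda>i. cell_index T l A i x) {..<n})"
  have "name ` space M \<subseteq> PiE {..<n} (\<lambda>_. {1..l})"
    using cell_index_iff by (fastforce simp: name_def)
  then have "finite (name ` space M)"
    by (rule finite_subset) (intro finite_PiE; simp)
  then obtain F where F: "F \<subseteq> space M" "finite F" "name ` space M = name ` F"
    using finite_subset_image[of "name ` space M" name "space M"] by auto
  have "(\<Union>x\<in>F. hamming_ball M T l A n x \<epsilon>) = space M"
  proof
    show "space M \<subseteq> (\<Union>x\<in>F. hamming_ball M T l A n x \<epsilon>)"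
    proof
      fix y assume y: "y \<in> space M"
      then obtain x where x: "x \<in> F" "name y = name x" using F(3) by blast
      have "cell_index T l A i x = cell_index T l A i y" if "i < n" for i
        using fun_cong[OF x(2), of i] that by (simp add: name_def)
      then have "hamming_dist T l A n x y = 0"
        by (simp add: hamming_dist_eq_sum)
      then have "y \<in> hamming_ball M T l A n x \<epsilon>"
        using y assms by (simp add: hamming_ball_def)
      with x(1) show "y \<in> (\<Union>x\<in>F. hamming_ball M T l A n x \<epsilon>)" by blast
    qed
  qed (auto simp: hamming_ball_def)
  then show ?thesis using F assms by (intro exI[of _ F]) (simp add: prob_space)
qed

lemma measure_complexity_witness:
  assumes "\<epsilon> > 0"
  shows "\<exists>F. finite F \<and> F \<subseteq> space M \<and> card F = measure_complexity M T n l A \<epsilon>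
    \<and> measure M (\<Union>x\<in>F. hamming_ball M T l A n x \<epsilon>) > 1 - \<epsilon>"
  unfolding measure_complexity_def by (rule LeastI_ex) (use hamming_cover[OF assms] in blast)

lemma measure_complexity_le:
  assumes "finite F" "F \<subseteq> space M" "measure M (\<Union>x\<in>F. hamming_ball M T l A n x \<epsilon>) > 1 - \<epsilon>"
  shows "measure_complexity M T n l A \<epsilon> \<le> card F"
  unfolding measure_complexity_def by (rule Least_le) (use assms in blast)

text \<open>The pairing of the indicator \<open>f\<close> with \<open>g\<close> does not change when
  both are moved to time \<open>i\<close>, so it may be averaged over \<open>i < n\<close>. The
  balls are made disjoint, and on each piece \<open>f o T^i\<close> is replaced by its value at the
  centre. The step functions contribute \<open>sqrt \<delta>\<close> per piece through
  \<open>wm\<close>; the errors have total squared norm at most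
  \<open>2 * n * \<epsilon>\<close>.\<close>

lemma inner_cell_le:
  assumes h: "h \<in> {1..l}" and g: "g \<in> L2_space M" and n: "n > 0" and \<delta>: "\<delta> \<ge> 0" and \<epsilon>: "\<epsilon> > 0"
    and wm: "\<And>w. w \<in> L2_space M \<Longrightarrow>
      (\<Sum>i<n. (cmod (L2_inner M w (\<lambda>x. g ((T ^^ i) x))))\<^sup>2) \<le> \<delta> * real n * (L2_nrm M w)\<^sup>2"
    and F: "finite F" "F \<subseteq> space M"
    and cover: "measure M (\<Union>x\<in>F. hamming_ball M T l A n x \<epsilon>) > 1 - \<epsilon>"
  shows "cmod (L2_inner M (indicator (A h)) g) \<le> real (card F) * sqrt \<delta> + sqrt (2 * \<epsilon>) * L2_nrm M g"
proof -
  define f :: "'a \<Rightarrow> complex" where "f = indicator (A h)"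
  define m where "m = card F"
  have f: "f \<in> L2_space M" unfolding f_def by (intro indicator_L2 cell_sets h)
  have f_eq: "f ((T ^^ i) y) = of_bool (cell_index T l A i y = h)" if "y \<in> space M" for i y
    using cell_index_iff[OF that, of i h] h by (auto simp: f_def indicator_def)
  obtain x where x: "bij_betw x {..<m} F"
    using ex_bij_betw_nat_finite[OF F(1)] by (auto simp: m_def atLeast0LessThan)
  \<comment> \<open>Padded with empty sets, because \<open>disjointed\<close> acts on
    sequences.\<close>
  define B where "B = (\<lambda>k. if k < m then hamming_ball M T l A n (x k) \<epsilon> else {})"
  define P where "P = disjointed B"
  define W where "W = (\<Union>k<m. P k)"
  have B_sets: "range B \<subseteq> sets M" by (auto simp: B_def)
  have P_sets: "P k \<in> sets M" for k
    using sets.range_disjointed_sets[OF B_sets] by (auto simp: P_def)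
  have P_B: "P k \<subseteq> B k" for k unfolding P_def by (rule disjointed_subset)
  have P_disj: "y \<notin> P j" if "y \<in> P k" "j \<noteq> k" for y j k
    using disjoint_family_disjointed[of B] that by (auto simp: P_def disjoint_family_on_def)
  have W_eq: "W = (\<Union>y\<in>F. hamming_ball M T l A n y \<epsilon>)"
  proof -
    have "k < m" if "y \<in> P k" for k y
      using subsetD[OF P_B that] by (auto simp: B_def split: if_splits)
    then have "W = (\<Union>k. P k)" unfolding W_def by blast
    also have "\<dots> = (\<Union>k. B k)" unfolding P_def by (rule UN_disjointed_eq)
    also have "\<dots> = (\<Union>k<m. hamming_ball M T l A n (x k) \<epsilon>)" by (auto simp: B_def split: if_splits)
    also have "\<dots> = (\<Union>y\<in>F. hamming_ball M T l A n y \<epsilon>)"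
      unfolding bij_betw_imp_surj_on[OF x, symmetric] by blast
    finally show ?thesis .
  qed
  have W_sets: "W \<in> sets M" unfolding W_def using P_sets by auto
  have x_space: "x k \<in> space M" if "k < m" for k
    using x F(2) that by (auto simp: bij_betw_def)
  \<comment> \<open>\<open>a i k\<close> is the value at the centre and \<open>r i\<close> the
    error. On \<open>P k\<close> the error can be nonzero only at times when the cell indices of the
    point and of the centre differ; outside \<open>W\<close> it is all of
    \<open>f o T^i\<close>.\<close>
  define a where "a = (\<lambda>i k. f ((T ^^ i) (x k)))"
  define r where "r = (\<lambda>i y. f ((T ^^ i) y) - (\<Sum>k<m. a i k * indicator (P k) y))"
  have aP: "(\<lambda>y. a i k * indicator (P k) y) \<in> L2_space M" for i k
    by (intro L2_space_scale indicator_L2 P_sets)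
  have r: "r i \<in> L2_space M" for i
    unfolding r_def by (intro L2_space_diff L2_space_sum L2_space_funpow f aP)
  have r_on: "r i y = f ((T ^^ i) y) - a i k" if "y \<in> P k" "k < m" for i k y
  proof -
    have "(\<Sum>j<m. a i j * indicator (P j) y) = (\<Sum>j<m. if j = k then a i k else 0)"
      using P_disj[OF that(1)] that(1) by (intro sum.cong) auto
    then show ?thesis using that(2) by (simp add: r_def)
  qed
  have r_off: "r i y = f ((T ^^ i) y)" if "y \<notin> W" for i y
    using that by (auto simp: r_def W_def intro!: sum.neutral)
  have r_le1: "cmod (r i y) \<le> 1" if "y \<in> space M" for i y
  proof (cases "y \<in> W")
    case True
    then obtain k where "k < m" "y \<in> P k" by (auto simp: W_def)
    then show ?thesis
      using f_eq[OF that, of i] f_eq[OF x_space[of k], of i] by (simp add: r_on a_def)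
  next
    case False
    then show ?thesis using f_eq[OF that, of i] by (simp add: r_off)
  qed
  have r_sum: "(\<Sum>i<n. cmod (r i y)) \<le> real n * \<epsilon> + real n * indicator (space M - W) y"
    if y: "y \<in> space M" for y
  proof (cases "y \<in> W")
    case True
    then obtain k where k: "k < m" "y \<in> P k" by (auto simp: W_def)
    have "y \<in> hamming_ball M T l A n (x k) \<epsilon>" using P_B[of k] k by (auto simp: B_def)
    then have hd: "hamming_dist T l A n (x k) y < \<epsilon>" by (simp add: hamming_ball_def)
    have "(\<Sum>i<n. cmod (r i y)) \<le> (\<Sum>i<n. of_bool (cell_index T l A i (x k) \<noteq> cell_index T l A i y))"
      using f_eq[OF y] f_eq[OF x_space[OF k(1)]]
      by (intro sum_mono) (simp add: r_on[OF k(2,1)] a_def)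
    also have "\<dots> = real n * hamming_dist T l A n (x k) y"
      using n by (simp add: hamming_dist_eq_sum)
    also have "\<dots> \<le> real n * \<epsilon>" using hd by (intro mult_left_mono) auto
    finally show ?thesis using True by simp
  next
    case False
    have "(\<Sum>i<n. cmod (r i y)) \<le> (\<Sum>i<n. 1)" by (intro sum_mono r_le1 y)
    then have "(\<Sum>i<n. cmod (r i y)) \<le> real n" by simp
    also have "\<dots> \<le> real n * \<epsilon> + real n * indicator (space M - W) y"
      using False y \<epsilon> by simp
    finally show ?thesis .
  qed
  have r_nrm: "(\<Sum>i<n. (L2_nrm M (r i))\<^sup>2) \<le> 2 * real n * \<epsilon>"
  proof -
    have int_r: "integrable M (\<lambda>y. cmod (r i y))" for i
      using L2_space_integrable1[OF r] by simp
    \<comment> \<open>As \<open>|r i| \<le> 1\<close>, squares are bounded by moduli, and these are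
      summed pointwise: at most \<open>n * \<epsilon>\<close> inside the balls, and at most
      \<open>n\<close> on the uncovered set of measure at most \<open>\<epsilon>\<close>.\<close>
    have "(\<Sum>i<n. (L2_nrm M (r i))\<^sup>2) \<le> (\<Sum>i<n. \<integral>y. cmod (r i y) \<partial>M)"
      unfolding L2_nrm_power2
    proof (intro sum_mono integral_mono)
      show "integrable M (\<lambda>y. (cmod (r i y))\<^sup>2)" for i by (rule L2_space_integrable[OF r])
      show "integrable M (\<lambda>y. cmod (r i y))" for i by (rule int_r)
      show "(cmod (r i y))\<^sup>2 \<le> cmod (r i y)" if "y \<in> space M" for i y
        using r_le1[OF that, of i] by (simp add: power2_eq_square mult_left_le)
    qed
    also have "\<dots> = (\<integral>y. (\<Sum>i<n. cmod (r i y)) \<partial>M)"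
      by (rule Bochner_Integration.integral_sum[symmetric]) (rule int_r)
    also have "\<dots> \<le> (\<integral>y. real n * \<epsilon> + real n * indicator (space M - W) y \<partial>M)"
    proof (rule integral_mono)
      show "integrable M (\<lambda>y. \<Sum>i<n. cmod (r i y))"
        by (rule Bochner_Integration.integrable_sum) (rule int_r)
      show "integrable M (\<lambda>y. real n * \<epsilon> + real n * indicator (space M - W) y)"
        using W_sets by (intro Bochner_Integration.integrable_add integrable_mult_right)
          (auto simp: integrable_indicator_iff emeasure_eq_measure)
    qed (rule r_sum)
    also have "\<dots> = real n * \<epsilon> + real n * measure M (space M - W)"
      using W_sets by (simp add: emeasure_eq_measure prob_space Int_absorb2)
    also have "measure M (space M - W) \<le> \<epsilon>"
      using prob_compl[OF W_sets] cover by (simp add: W_eq)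
    finally show ?thesis using n by (simp add: mult_ac)
  qed
  let ?U = "\<lambda>i y. g ((T ^^ i) y)"
  have U: "?U i \<in> L2_space M" for i by (rule L2_space_funpow[OF g])
  have split: "L2_inner M f g = (\<Sum>k<m. a i k * L2_inner M (indicator (P k)) (?U i)) + L2_inner M (r i) (?U i)" for i
  proof -
    have "L2_inner M f g = L2_inner M (\<lambda>y. f ((T ^^ i) y)) (?U i)"
      by (rule L2_inner_funpow[OF f g, symmetric])
    also have "(\<lambda>y. f ((T ^^ i) y)) = (\<lambda>y. (\<Sum>k<m. a i k * indicator (P k) y) + r i y)"
      by (simp add: r_def)
    also have "L2_inner M \<dots> (?U i) = L2_inner M (\<lambda>y. \<Sum>k<m. a i k * indicator (P k) y) (?U i) + L2_inner M (r i) (?U i)"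
      by (intro L2_inner_add_left L2_space_sum aP r U)
    also have "L2_inner M (\<lambda>y. \<Sum>k<m. a i k * indicator (P k) y) (?U i)
        = (\<Sum>k<m. a i k * L2_inner M (indicator (P k)) (?U i))"
      by (subst L2_inner_sum_left) (simp_all add: aP U L2_inner_scale_left)
    finally show ?thesis .
  qed
  have a_le1: "cmod (a i k) \<le> 1" if "k < m" for i k
    using f_eq[OF x_space[OF that], of i] by (simp add: a_def)
  have "cmod (L2_inner M f g) \<le> (\<Sum>k<m. cmod (L2_inner M (indicator (P k)) (?U i))) + L2_nrm M (r i) * L2_nrm M g" for i
  proof -
    have "cmod (L2_inner M f g) \<le> cmod (\<Sum>k<m. a i k * L2_inner M (indicator (P k)) (?U i)) + cmod (L2_inner M (r i) (?U i))"
      unfolding split[of i] by (rule norm_triangle_ineq)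
    also have "cmod (\<Sum>k<m. a i k * L2_inner M (indicator (P k)) (?U i)) \<le> (\<Sum>k<m. cmod (L2_inner M (indicator (P k)) (?U i)))"
      by (rule sum_norm_le) (use a_le1 in \<open>auto simp: norm_mult intro!: mult_left_le_one_le\<close>)
    also have "cmod (L2_inner M (r i) (?U i)) \<le> L2_nrm M (r i) * L2_nrm M g"
      using L2_Cauchy_Schwarz[OF r U, of i i] by (simp add: L2_nrm_funpow g)
    finally show ?thesis by simp
  qed
  then have "(\<Sum>i<n. cmod (L2_inner M f g))
      \<le> (\<Sum>i<n. (\<Sum>k<m. cmod (L2_inner M (indicator (P k)) (?U i))) + L2_nrm M (r i) * L2_nrm M g)"
    by (intro sum_mono)
  also have "\<dots> = (\<Sum>k<m. \<Sum>i<n. cmod (L2_inner M (indicator (P k)) (?U i))) + (\<Sum>i<n. L2_nrm M (r i)) * L2_nrm M g"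
    unfolding sum.distrib sum_distrib_right by (subst sum.swap) (rule refl)
  also have "(\<Sum>k<m. \<Sum>i<n. cmod (L2_inner M (indicator (P k)) (?U i))) \<le> (\<Sum>k<m. real n * sqrt \<delta>)"
  proof (rule sum_mono)
    fix k
    \<comment> \<open>Cauchy-Schwarz over the times \<open>i\<close> passes from the sum to the sum
      of squares that \<open>wm\<close> controls.\<close>
    have "(\<Sum>i<n. cmod (L2_inner M (indicator (P k)) (?U i)))\<^sup>2
        \<le> (\<Sum>i<n. (cmod (L2_inner M (indicator (P k)) (?U i)))\<^sup>2) * real n"
      using sum_squared_le_sum_of_squares[of "\<lambda>i. cmod (L2_inner M (indicator (P k)) (?U i))" "{..<n}"] by simp
    also have "\<dots> \<le> (\<delta> * real n * (L2_nrm M (indicator (P k)))\<^sup>2) * real n"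
      by (intro mult_right_mono wm indicator_L2 P_sets) simp
    also have "\<dots> \<le> (\<delta> * real n * 1) * real n"
      using indicator_nrm_le_1[OF P_sets[of k]] \<delta>
      by (intro mult_right_mono mult_left_mono) (auto simp: power_le_one)
    also have "\<dots> = (real n * sqrt \<delta>)\<^sup>2"
      using \<delta> by (simp add: power_mult_distrib power2_eq_square)
    finally show "(\<Sum>i<n. cmod (L2_inner M (indicator (P k)) (?U i))) \<le> real n * sqrt \<delta>"
      by (rule power2_le_imp_le) (use \<delta> in simp)
  qed
  also have "(\<Sum>k<m. real n * sqrt \<delta>) = real n * (real m * sqrt \<delta>)" by simp
  also have "(\<Sum>i<n. L2_nrm M (r i)) * L2_nrm M g \<le> (real n * sqrt (2 * \<epsilon>)) * L2_nrm M g"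
  proof (rule mult_right_mono)
    have "(\<Sum>i<n. L2_nrm M (r i))\<^sup>2 \<le> (\<Sum>i<n. (L2_nrm M (r i))\<^sup>2) * real n"
      using sum_squared_le_sum_of_squares[of "\<lambda>i. L2_nrm M (r i)" "{..<n}"] by simp
    also have "\<dots> \<le> (2 * real n * \<epsilon>) * real n"
      by (intro mult_right_mono r_nrm) simp
    also have "\<dots> = (real n * sqrt (2 * \<epsilon>))\<^sup>2"
      using \<epsilon> by (simp add: power_mult_distrib power2_eq_square)
    finally show "(\<Sum>i<n. L2_nrm M (r i)) \<le> real n * sqrt (2 * \<epsilon>)"
      by (rule power2_le_imp_le) (use \<epsilon> in simp)
  qed simp
  finally have "real n * cmod (L2_inner M f g) \<le> real n * (real m * sqrt \<delta> + sqrt (2 * \<epsilon>) * L2_nrm M g)"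
    by (simp add: distrib_left mult.assoc)
  then show ?thesis
    using n by (simp add: f_def m_def)
qed

text \<open>Two limits in a fixed order: for given \<open>\<epsilon>\<close> the number of balls
  stays below \<open>C\<close> however large \<open>n\<close> is, so \<open>\<delta>\<close> can
  tend to zero first and remove the term \<open>C * \<delta>\<close>; then \<open>\<epsilon>\<close>
  tends to zero.\<close>

lemma inner_cell_eq_0:
  assumes h: "h \<in> {1..l}" and g: "g \<in> L2_space M"
    and orth: "\<And>e. eigenfunction M T e \<Longrightarrow> L2_inner M g e = 0"
    and bdd: "\<And>\<epsilon>. \<epsilon> > 0 \<Longrightarrow> \<exists>C>0. \<forall>n\<ge>1. real (measure_complexity M T n l A \<epsilon>) \<le> C"
  shows "L2_inner M (indicator (A h)) g = 0"
proof -
  have le: "cmod (L2_inner M (indicator (A h)) g) \<le> C * \<delta> + sqrt (2 * \<epsilon>) * L2_nrm M g"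
    if \<epsilon>: "\<epsilon> > 0" and \<delta>: "\<delta> > 0" and C: "\<forall>n\<ge>1. real (measure_complexity M T n l A \<epsilon>) \<le> C" for \<epsilon> \<delta> C
  proof -
    \<comment> \<open>The mixing bound is requested for the square of \<open>\<delta>\<close>, which
      cancels the square root in \<open>inner_cell_le\<close>.\<close>
    obtain n where n: "n > 0" and wm: "\<forall>w\<in>L2_space M.
        (\<Sum>i<n. (cmod (L2_inner M w (\<lambda>x. g ((T ^^ i) x))))\<^sup>2) \<le> \<delta>\<^sup>2 * real n * (L2_nrm M w)\<^sup>2"
      using weak_mixing_average[OF g orth, of "\<delta>\<^sup>2"] \<delta> by auto
    obtain F where F: "finite F" "F \<subseteq> space M" "card F = measure_complexity M T n l A \<epsilon>"
      "measure M (\<Union>x\<in>F. hamming_ball M T l A n x \<epsilon>) > 1 - \<epsilon>"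
      using measure_complexity_witness[OF \<epsilon>] by blast
    have "cmod (L2_inner M (indicator (A h)) g) \<le> real (card F) * sqrt (\<delta>\<^sup>2) + sqrt (2 * \<epsilon>) * L2_nrm M g"
      by (rule inner_cell_le[OF h g n _ \<epsilon> _ F(1,2,4)]) (use wm in auto)
    also have "real (card F) * sqrt (\<delta>\<^sup>2) \<le> C * \<delta>"
      using C n F(3) \<delta> by (simp add: mult_right_mono)
    finally show ?thesis by simp
  qed
  have le': "cmod (L2_inner M (indicator (A h)) g) \<le> sqrt (2 * \<epsilon>) * L2_nrm M g" if \<epsilon>: "\<epsilon> > 0" for \<epsilon>
  proof -
    obtain C where C: "C > 0" "\<forall>n\<ge>1. real (measure_complexity M T n l A \<epsilon>) \<le> C"
      using bdd[OF \<epsilon>] by blast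
    show ?thesis
    proof (rule field_le_epsilon)
      fix e :: real assume "e > 0"
      then show "cmod (L2_inner M (indicator (A h)) g) \<le> sqrt (2 * \<epsilon>) * L2_nrm M g + e"
        using le[OF \<epsilon> _ C(2), of "e / C"] C(1) by simp
    qed
  qed
  have "cmod (L2_inner M (indicator (A h)) g) \<le> 0 + e" if e: "e > 0" for e
  proof -
    \<comment> \<open>With \<open>\<epsilon> = d\<^sup>2 / 2\<close> the factor
      \<open>sqrt (2 * \<epsilon>)\<close> equals \<open>d\<close>.\<close>
    define d where "d = e / (L2_nrm M g + 1)"
    have pos: "L2_nrm M g + 1 > 0" by (simp add: add_nonneg_pos)
    have d: "d > 0" using e pos by (simp add: d_def)
    have "cmod (L2_inner M (indicator (A h)) g) \<le> d * L2_nrm M g"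
      using le'[of "d\<^sup>2 / 2"] d by simp
    also have "\<dots> \<le> d * (L2_nrm M g + 1)" using d by (intro mult_left_mono) auto
    also have "\<dots> = e" using pos by (simp add: d_def)
    finally show ?thesis by simp
  qed
  then have "cmod (L2_inner M (indicator (A h)) g) \<le> 0"
    by (rule field_le_epsilon)
  then show ?thesis by simp
qed

end

context measure_preserving_map
begin

text \<open>If the span is not dense, some \<open>g\<close> orthogonal to it pairs nontrivially with
  \<open>f\<close>. Partitions into a set and its complement suffice to show that \<open>g\<close>
  is orthogonal to every indicator, hence zero.\<close>

lemma discrete_spectrum_if_bounded_complexity:
  assumes bdd: "\<And>l A \<epsilon>. finite_measurable_partition M l A \<Longrightarrow> \<epsilon> > 0 \<Longrightarrow>
    \<exists>C>0. \<forall>n\<ge>1. real (measure_complexity M T n l A \<epsilon>) \<le> C"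
  shows "discrete_spectrum M T"
proof (rule ccontr)
  define E where "E = {e. eigenfunction M T e}"
  assume "\<not> discrete_spectrum M T"
  then obtain f where f: "f \<in> L2_space M" "f \<notin> L2_closure M (complex_span E)"
    by (auto simp: discrete_spectrum_def E_def L2_closure_def)
  have "E \<subseteq> L2_space M" by (auto simp: E_def eigenfunction_def)
  moreover have "(\<lambda>x. 0) \<in> complex_span E"
    unfolding complex_span_def by (rule CollectI, rule exI[of _ "{}"]) simp
  ultimately obtain g where g: "g \<in> L2_space M" and orth: "\<forall>v\<in>complex_span E. L2_inner M v g = 0"
    and fg: "L2_inner M f g \<noteq> 0"
    using L2_projection[OF f(1) complex_span_L2 _ complex_span_lin f(2)] by blast
  have orth_eig: "L2_inner M g e = 0" if "eigenfunction M T e" for e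
  proof -
    have "L2_inner M e g = 0" using orth complex_span_base[of e E] that by (auto simp: E_def)
    then show ?thesis using L2_inner_cnj[of M e g] by simp
  qed
  have ind: "L2_inner M (indicator B) g = 0" if B: "B \<in> sets M" for B
  proof -
    \<comment> \<open>Cells have to be nonempty, so the two trivial sets are treated apart; for the
      whole space, the constant 1 is itself an eigenfunction.\<close>
    consider "B = {}" | "B = space M" | "B \<noteq> {}" "B \<noteq> space M" by blast
    then show ?thesis
    proof cases
      case 1
      then show ?thesis by (simp add: L2_inner_def)
    next
      case 2
      have "eigenfunction M T (\<lambda>_. 1)"
        unfolding eigenfunction_def using L2_space_const[of 1] prob_space
        by (auto intro!: exI[of _ 1])
      then have "L2_inner M (\<lambda>_. 1) g = 0" using orth_eig L2_inner_cnj[of M g "\<lambda>_. 1"] by simp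
      moreover have "L2_inner M (indicator B) g = L2_inner M (\<lambda>_. 1) g"
        unfolding L2_inner_def 2 by (intro Bochner_Integration.integral_cong) auto
      ultimately show ?thesis by simp
    next
      case 3
      define A where "A = (\<lambda>i::nat. if i = 1 then B else space M - B)"
      have BM: "B \<subseteq> space M" using sets.sets_into_space[OF B] .
      have img: "A ` {1..2} = {B, space M - B}"
      proof -
        have "{1..2::nat} = {1, 2}" by auto
        then show ?thesis by (auto simp: A_def)
      qed
      have "finite_measurable_partition M 2 A"
        unfolding finite_measurable_partition_def img
      proof (intro conjI)
        show "{B, space M - B} \<subseteq> sets M" using B by auto
        show "inj_on A {1..2}" using 3 BM by (auto simp: inj_on_def A_def split: if_splits)
        show "partition_on (space M) {B, space M - B}"
          using 3 BM by (auto simp: partition_on_def disjoint_def)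
      qed
      then interpret partitioned_map M T 2 A by unfold_locales
      have "L2_inner M (indicator (A 1)) g = 0"
        by (rule inner_cell_eq_0[OF _ g orth_eig bdd[OF partition]]) auto
      then show ?thesis by (simp add: A_def)
    qed
  qed
  \<comment> \<open>Pairing an indicator with \<open>g\<close> integrates \<open>cnj g\<close> over
    the set, so \<open>cnj g\<close> is a density with all integrals zero.\<close>
  have "AE x in M. cnj (g x) = 0"
  proof (rule density_zero)
    show "integrable M (\<lambda>x. cnj (g x))" using L2_space_integrable1[OF g] by simp
    show "set_lebesgue_integral M B (\<lambda>x. cnj (g x)) = 0" if "B \<in> sets M" for B
    proof -
      have "set_lebesgue_integral M B (\<lambda>x. cnj (g x)) = L2_inner M (indicator B) g"
        unfolding set_lebesgue_integral_def L2_inner_def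
        by (intro Bochner_Integration.integral_cong) (auto simp: indicator_def)
      then show ?thesis using ind[OF that] by simp
    qed
  qed
  then have "L2_nrm M g = 0" using L2_nrm_eq_0_iff[OF g] by simp
  then show False using L2_Cauchy_Schwarz[OF f(1) g] fg by simp
qed

end

section \<open>Discrete spectrum implies bounded complexity\<close>

context measure_preserving_map
begin

text \<open>Off a small set Markov's inequality bounds each function, so its values lie in a disc,
  which is covered by finitely many small balls; the pieces are intersections of preimages.
  Measurability is asked of \<open>G\<close> alone: the pieces serve to choose centres, and their
  number is what counts.\<close>

lemma finite_L2_family_almost_precompact:
  assumes "finite E" "E \<subseteq> L2_space M" "s > 0" "\<eta> > 0"
  shows "\<exists>G\<in>sets M. measure M (space M - G) < \<eta> \<and>
    (\<exists>\<P>. finite \<P> \<and> G \<subseteq> \<Union>\<P> \<and> (\<forall>P\<in>\<P>. \<forall>x\<in>P. \<forall>y\<in>P. \<forall>e\<in>E. cmod (e x - e y) < s))"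
  using assms(1,2,4)
proof (induction E arbitrary: \<eta> rule: finite_induct)
  case empty
  then show ?case
    by (intro bexI[of _ "space M"] conjI exI[of _ "{space M}"]) auto
next
  case (insert f E)
  have f: "f \<in> L2_space M" using insert.prems by simp
  note [measurable] = L2_space_measurable[OF f]
  have \<eta>2: "\<eta> / 2 > 0" using insert.prems by simp
  have "E \<subseteq> L2_space M" using insert.prems by simp
  from insert.IH[OF this \<eta>2] obtain G \<P> where G: "G \<in> sets M" "measure M (space M - G) < \<eta> / 2"
    and P: "finite \<P>" "G \<subseteq> \<Union>\<P>" "\<forall>P\<in>\<P>. \<forall>x\<in>P. \<forall>y\<in>P. \<forall>e\<in>E. cmod (e x - e y) < s"
    by blast
  define I where "I = (\<integral>x. cmod (f x) \<partial>M)"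
  have I: "I \<ge> 0" by (simp add: I_def)
  \<comment> \<open>Chosen so that \<open>\<eta> / 2 * B\<close> exceeds \<open>I\<close>; the
    \<open>+ 1\<close> makes this strict and keeps \<open>B\<close> positive.\<close>
  define B where "B = 2 * I / \<eta> + 1"
  have B: "B > 0" using I insert.prems by (simp add: B_def add_nonneg_pos)
  define H where "H = {x \<in> space M. cmod (f x) < B}"
  have H: "H \<in> sets M" unfolding H_def by measurable
  have compl: "space M - H = {x \<in> space M. cmod (f x) \<ge> B}" by (auto simp: H_def)
  have Markov: "measure M {x \<in> space M. cmod (f x) \<ge> B} \<le> I / B"
    unfolding I_def using L2_space_integrable1[OF f] B
    by (intro integral_Markov_inequality_measure[where A = "{}"]) auto
  have small: "I / B < \<eta> / 2"
  proof -
    have "\<eta> / 2 * B = I + \<eta> / 2" using insert.prems by (simp add: B_def field_simps)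
    then have "I < \<eta> / 2 * B" using insert.prems by simp
    then show ?thesis using B by (simp add: pos_divide_less_eq)
  qed
  have H_small: "measure M (space M - H) < \<eta> / 2"
    unfolding compl by (rule le_less_trans[OF Markov small])
  have "\<forall>e>0. \<exists>K. finite K \<and> cball (0::complex) B \<subseteq> (\<Union>c\<in>K. ball c e)"
    using compact_cball[of "0::complex" B] by (simp add: compact_eq_totally_bounded)
  then obtain K where K: "finite K" "cball (0::complex) B \<subseteq> (\<Union>c\<in>K. ball c (s / 2))"
    using \<open>s > 0\<close> half_gt_zero by metis
  define \<Q> where "\<Q> = (\<lambda>(P, c). P \<inter> f -` ball c (s / 2)) ` (\<P> \<times> K)"
  have "finite \<Q>" unfolding \<Q>_def using P K by simp
  moreover have "G \<inter> H \<subseteq> \<Union>\<Q>"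
  proof
    fix x assume x: "x \<in> G \<inter> H"
    then obtain p where p: "p \<in> \<P>" "x \<in> p" using P by blast
    have "f x \<in> cball 0 B" using x by (simp add: H_def)
    then obtain c where c: "c \<in> K" "f x \<in> ball c (s / 2)" using K by blast
    have "p \<inter> f -` ball c (s / 2) \<in> \<Q>"
      unfolding \<Q>_def by (rule image_eqI[of _ _ "(p, c)"]) (use p c in auto)
    then show "x \<in> \<Union>\<Q>" using p c by blast
  qed
  moreover have "cmod (e x - e y) < s" if Q: "Q \<in> \<Q>" "x \<in> Q" "y \<in> Q" and e: "e \<in> insert f E" for Q x y e
  proof -
    obtain p c where pc: "p \<in> \<P>" "Q = p \<inter> f -` ball c (s / 2)"
      using Q(1) by (auto simp: \<Q>_def)
    show ?thesis
    proof (cases "e = f")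
      case True
      have "dist c (f x) < s / 2" "dist c (f y) < s / 2" using Q(2,3) pc by auto
      then have "dist (f x) (f y) < s" by (rule dist_triangle_half_r)
      then show ?thesis by (simp add: True dist_norm)
    next
      case False
      then have "e \<in> E" using e by simp
      moreover have "x \<in> p" "y \<in> p" using Q(2,3) pc by auto
      ultimately show ?thesis using P(3) pc(1) by blast
    qed
  qed
  moreover have "measure M (space M - G \<inter> H) < \<eta>"
  proof -
    have "space M - G \<inter> H = (space M - G) \<union> (space M - H)" by blast
    then have "measure M (space M - G \<inter> H) \<le> measure M (space M - G) + measure M (space M - H)"
      using measure_Un_le[of "space M - G" M "space M - H"] G H by simp
    then show ?thesis using G(2) H_small by simp
  qed
  moreover have "G \<inter> H \<in> sets M" using G(1) H by simp
  ultimately show ?case by (intro bexI[of _ "G \<inter> H"] conjI exI[of _ \<Q>]) blast+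
qed

end

context partitioned_map
begin

text \<open>A disagreement at time \<open>i\<close> costs at most the approximation errors at the
  two orbit points plus \<open>\<epsilon> / 4\<close>. Time averages of the error have the same
  integral for every \<open>n\<close>, so the Markov estimate is uniform in \<open>n\<close>. The
  set \<open>G\<close> and the pieces are fixed before \<open>n\<close>; the exceptional set
  \<open>D\<close> and the centres vary with \<open>n\<close>, but there is at most one centre per
  piece.\<close>

lemma bounded_complexity_if_discrete_spectrum:
  assumes ds: "discrete_spectrum M T" and \<epsilon>: "\<epsilon> > 0"
  shows "\<exists>C>0. \<forall>n\<ge>1. real (measure_complexity M T n l A \<epsilon>) \<le> C"
proof -
  \<comment> \<open>The total error has integral at most \<open>l * \<delta>\<close>; Markov at
    level \<open>\<epsilon> / 4\<close> then gives measure at most \<open>\<epsilon> / 4\<close>.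
    Using \<open>l + 1\<close> keeps the denominator positive.\<close>
  define \<delta> where "\<delta> = \<epsilon>\<^sup>2 / (16 * (real l + 1))"
  have \<delta>: "\<delta> > 0" using \<epsilon> by (simp add: \<delta>_def add_nonneg_pos)
  define E where "E = {e. eigenfunction M T e}"
  have "\<forall>h\<in>{1..l}. \<exists>F c. finite F \<and> F \<subseteq> E \<and> L2_dist M (indicator (A h)) (\<lambda>x. \<Sum>e\<in>F. c e * e x) < \<delta>"
  proof
    fix h assume that: "h \<in> {1..l}"
    have "indicator (A h) \<in> L2_closure M (complex_span E)"
      using ds indicator_L2[OF cell_sets[OF that]] by (simp add: discrete_spectrum_def E_def)
    then obtain u where "u \<in> complex_span E" "L2_dist M (indicator (A h)) u < \<delta>"
      using \<delta> by (auto simp: L2_closure_def)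
    then show "\<exists>F c. finite F \<and> F \<subseteq> E \<and> L2_dist M (indicator (A h)) (\<lambda>x. \<Sum>e\<in>F. c e * e x) < \<delta>"
      unfolding complex_span_def by blast
  qed
  from bchoice[OF this] obtain F where
    "\<forall>h\<in>{1..l}. \<exists>c. finite (F h) \<and> F h \<subseteq> E \<and> L2_dist M (indicator (A h)) (\<lambda>x. \<Sum>e\<in>F h. c e * e x) < \<delta>" ..
  from bchoice[OF this] obtain c where Fc:
    "\<forall>h\<in>{1..l}. finite (F h) \<and> F h \<subseteq> E \<and> L2_dist M (indicator (A h)) (\<lambda>x. \<Sum>e\<in>F h. c h e * e x) < \<delta>" ..
  have F: "finite (F h)" "F h \<subseteq> E"
    and close: "L2_dist M (indicator (A h)) (\<lambda>x. \<Sum>e\<in>F h. c h e * e x) < \<delta>" if "h \<in> {1..l}" for h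
    using bspec[OF Fc that] by simp_all
  define u where "u = (\<lambda>h x. \<Sum>e\<in>F h. c h e * e x)"
  define EF where "EF = (\<Union>h\<in>{1..l}. F h)"
  have EF: "finite EF" "EF \<subseteq> E"
    unfolding EF_def by (rule finite_UN_I[OF finite_atLeastAtMost F(1)], assumption) (rule UN_least[OF F(2)])
  have E_L2: "E \<subseteq> L2_space M" by (auto simp: E_def eigenfunction_def)
  have "\<forall>e\<in>EF. \<exists>z. cmod z = 1 \<and> (AE x in M. \<forall>i. e ((T ^^ i) x) = z ^ i * e x)"
  proof
    fix e assume "e \<in> EF"
    then have "eigenfunction M T e" using EF by (auto simp: E_def)
    then obtain z where e: "e \<in> L2_space M" "\<not> (AE x in M. e x = 0)" and z: "AE x in M. e (T x) = z * e x"
      by (auto simp: eigenfunction_def)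
    show "\<exists>z. cmod z = 1 \<and> (AE x in M. \<forall>i. e ((T ^^ i) x) = z ^ i * e x)"
      using eigenvalue_cmod[OF e z] eigenfunction_funpow[OF z] by blast
  qed
  from bchoice[OF this] obtain z where
    z: "\<forall>e\<in>EF. cmod (z e) = 1 \<and> (AE x in M. \<forall>i. e ((T ^^ i) x) = z e ^ i * e x)" ..
  have z1: "cmod (z e) = 1" and zAE: "AE x in M. \<forall>i. e ((T ^^ i) x) = z e ^ i * e x" if "e \<in> EF" for e
    using bspec[OF z that] by simp_all
  have "AE x in M. \<forall>e\<in>EF. \<forall>i. e ((T ^^ i) x) = z e ^ i * e x"
    by (rule AE_finite_allI[OF EF(1)]) (rule zAE)
  then obtain N where N: "{x \<in> space M. \<not> (\<forall>e\<in>EF. \<forall>i. e ((T ^^ i) x) = z e ^ i * e x)} \<subseteq> N"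
    "emeasure M N = 0" "N \<in> sets M"
    by (rule AE_E)
  define \<rho> where "\<rho> = (\<lambda>x. \<Sum>h\<in>{1..l}. cmod (indicator (A h) x - u h x))"
  have u_L2: "u h \<in> L2_space M" if "h \<in> {1..l}" for h
    unfolding u_def using F(2)[OF that] E_L2 by (intro L2_space_sum L2_space_scale) auto
  have diff_L2: "(\<lambda>x. indicator (A h) x - u h x) \<in> L2_space M" if "h \<in> {1..l}" for h
    by (intro L2_space_diff indicator_L2 cell_sets u_L2 that)
  have int_h: "integrable M (\<lambda>x. cmod (indicator (A h) x - u h x))" if "h \<in> {1..l}" for h
    using L2_space_integrable1[OF diff_L2[OF that]] by simp
  have int_\<rho>: "integrable M \<rho>"
    unfolding \<rho>_def by (intro Bochner_Integration.integrable_sum int_h)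
  have \<rho>_nonneg: "\<rho> x \<ge> 0" for x unfolding \<rho>_def by (intro sum_nonneg) simp
  have integral_\<rho>: "(\<integral>x. \<rho> x \<partial>M) \<le> real l * \<delta>"
  proof -
    have "(\<integral>x. \<rho> x \<partial>M) = (\<Sum>h\<in>{1..l}. \<integral>x. cmod (indicator (A h) x - u h x) \<partial>M)"
      unfolding \<rho>_def by (rule Bochner_Integration.integral_sum) (rule int_h)
    also have "\<dots> \<le> (\<Sum>h\<in>{1..l}. \<delta>)"
    proof (rule sum_mono)
      fix h assume h: "h \<in> {1..l}"
      show "(\<integral>x. cmod (indicator (A h) x - u h x) \<partial>M) \<le> \<delta>"
        using L1_le_L2[OF diff_L2[OF h]] close[OF h] by (simp add: L2_dist_eq_nrm u_def)
    qed
    finally show ?thesis by simp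
  qed
  define \<kappa> where "\<kappa> = (\<Sum>h\<in>{1..l}. \<Sum>e\<in>F h. cmod (c h e))"
  have \<kappa>: "\<kappa> \<ge> 0" unfolding \<kappa>_def by (intro sum_nonneg) simp
  \<comment> \<open>If \<open>x\<close> and \<open>y\<close> agree within \<open>s\<close> on all of
    \<open>EF\<close>, each \<open>u h\<close> differs by at most \<open>\<kappa> * s\<close> along
    their orbits, which is made at most \<open>\<epsilon> / 4\<close>.\<close>
  define s where "s = \<epsilon> / (4 * (\<kappa> + 1))"
  have s: "s > 0" using \<epsilon> \<kappa> by (simp add: s_def add_nonneg_pos)
  have \<kappa>s: "\<kappa> * s \<le> \<epsilon> / 4"
  proof -
    have "\<kappa> * s \<le> (\<kappa> + 1) * s" using s by simp
    also have "\<dots> = \<epsilon> / 4" using \<kappa> by (simp add: s_def field_simps)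
    finally show ?thesis .
  qed
  obtain G \<P> where G: "G \<in> sets M" "measure M (space M - G) < \<epsilon> / 2"
    and P: "finite \<P>" "G \<subseteq> \<Union>\<P>"
    and P_close: "\<forall>P\<in>\<P>. \<forall>x\<in>P. \<forall>y\<in>P. \<forall>e\<in>EF. cmod (e x - e y) < s"
    using finite_L2_family_almost_precompact[OF EF(1) subset_trans[OF EF(2) E_L2] s half_gt_zero[OF \<epsilon>]]
    by (elim bexE conjE exE)
  \<comment> \<open>When the cells differ, let \<open>h\<close> be the cell of \<open>X\<close>: its
    indicator is 1 at \<open>X\<close> and 0 at \<open>Y\<close>, so 1 is split through
    \<open>u h X\<close> and \<open>u h Y\<close>. The middle difference is the one at time 0 up to
    unimodular factors, valid off \<open>N\<close>.\<close>
  have cell_le: "of_bool (cell_index T l A i x \<noteq> cell_index T l A i y)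
      \<le> \<rho> ((T ^^ i) x) + \<rho> ((T ^^ i) y) + \<epsilon> / 4"
    if xy: "x \<in> space M - N" "y \<in> space M - N" and xy_close: "\<And>e. e \<in> EF \<Longrightarrow> cmod (e x - e y) < s" for x y i
  proof (cases "cell_index T l A i x = cell_index T l A i y")
    case True
    then show ?thesis using \<rho>_nonneg \<epsilon> by (simp add: add_nonneg_nonneg)
  next
    case False
    define h where "h = cell_index T l A i x"
    define X where "X = (T ^^ i) x"
    define Y where "Y = (T ^^ i) y"
    have h: "h \<in> {1..l}" "X \<in> A h"
      using cell_index_iff[of x i h] xy by (auto simp: h_def X_def)
    have "Y \<notin> A h"
      using cell_index_iff[of y i h] xy False h(1) by (auto simp: h_def Y_def)
    have X\<rho>: "cmod (1 - u h X) \<le> \<rho> X"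
    proof -
      have "cmod (indicator (A h) X - u h X) \<le> \<rho> X"
        unfolding \<rho>_def by (rule member_le_sum) (use h in auto)
      then show ?thesis using h by simp
    qed
    have Y\<rho>: "cmod (u h Y) \<le> \<rho> Y"
    proof -
      have "cmod (indicator (A h) Y - u h Y) \<le> \<rho> Y"
        unfolding \<rho>_def by (rule member_le_sum) (use h in auto)
      then show ?thesis using \<open>Y \<notin> A h\<close> by simp
    qed
    have "cmod (u h X - u h Y) \<le> (\<Sum>e\<in>F h. cmod (c h e) * s)"
    proof -
      have "u h X - u h Y = (\<Sum>e\<in>F h. c h e * (e X - e Y))"
        by (simp add: u_def right_diff_distrib sum_subtractf)
      also have "cmod \<dots> \<le> (\<Sum>e\<in>F h. cmod (c h e) * s)"
      proof (rule sum_norm_le)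
        fix e assume e: "e \<in> F h"
        then have eEF: "e \<in> EF" using h(1) by (auto simp: EF_def)
        have "e X = z e ^ i * e x" "e Y = z e ^ i * e y"
          using N(1) xy eEF by (auto simp: X_def Y_def)
        then have "e X - e Y = z e ^ i * (e x - e y)" by (simp add: right_diff_distrib)
        then have "cmod (e X - e Y) \<le> s"
          using xy_close[OF eEF] by (simp add: norm_mult norm_power z1[OF eEF])
        then show "cmod (c h e * (e X - e Y)) \<le> cmod (c h e) * s"
          by (simp add: norm_mult mult_left_mono)
      qed
      finally show ?thesis .
    qed
    also have "\<dots> \<le> \<kappa> * s"
    proof -
      have "(\<Sum>e\<in>F h. cmod (c h e)) \<le> \<kappa>"
        unfolding \<kappa>_def by (rule member_le_sum[of h "{1..l}" "\<lambda>h. \<Sum>e\<in>F h. cmod (c h e)"])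
          (use h in \<open>auto intro: sum_nonneg\<close>)
      then show ?thesis using s by (simp add: mult_right_mono flip: sum_distrib_right)
    qed
    finally have XY: "cmod (u h X - u h Y) \<le> \<epsilon> / 4" using \<kappa>s by linarith
    have "1 = cmod ((1 - u h X) + (u h X - u h Y) + u h Y)" by simp
    also have "\<dots> \<le> cmod (1 - u h X) + cmod (u h X - u h Y) + cmod (u h Y)"
      by (rule order_trans[OF norm_triangle_ineq]) (intro add_right_mono norm_triangle_ineq)
    also have "\<dots> \<le> \<rho> X + \<rho> Y + \<epsilon> / 4" using X\<rho> Y\<rho> XY by linarith
    finally show ?thesis using False by (simp add: X_def Y_def)
  qed
  have bound: "measure_complexity M T n l A \<epsilon> \<le> card \<P>" if n: "n \<ge> 1" for n
  proof -
    define R where "R = (\<lambda>x. (\<Sum>i<n. \<rho> ((T ^^ i) x)) / real n)"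
    have int_R: "integrable M R"
      unfolding R_def by (intro integrable_divide Bochner_Integration.integrable_sum integrable_funpow int_\<rho>)
    note [measurable] = borel_measurable_integrable[OF int_R]
    have "(\<integral>x. R x \<partial>M) = (\<Sum>i<n. \<integral>x. \<rho> ((T ^^ i) x) \<partial>M) / real n"
      unfolding R_def
      by (subst integral_divide_zero) (simp add: Bochner_Integration.integral_sum integrable_funpow int_\<rho>)
    also have "\<dots> = (\<integral>x. \<rho> x \<partial>M)"
      using n by (simp add: integral_funpow borel_measurable_integrable[OF int_\<rho>])
    finally have integral_R: "(\<integral>x. R x \<partial>M) \<le> real l * \<delta>" using integral_\<rho> by simp
    have R_nonneg: "R x \<ge> 0" for x
      unfolding R_def by (intro divide_nonneg_nonneg sum_nonneg \<rho>_nonneg) simp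
    define D where "D = {x \<in> space M. R x \<ge> \<epsilon> / 4}"
    have D: "D \<in> sets M" unfolding D_def by measurable
    have "measure M D \<le> (\<integral>x. R x \<partial>M) / (\<epsilon> / 4)"
      unfolding D_def using \<epsilon> int_R R_nonneg
      by (intro integral_Markov_inequality_measure[where A = "{}"]) auto
    also have "\<dots> \<le> real l * \<delta> / (\<epsilon> / 4)"
      using integral_R \<epsilon> by (intro divide_right_mono) auto
    also have "\<dots> = \<epsilon> / 4 * (real l / (real l + 1))"
    proof -
      have eq: "real l * (\<epsilon>\<^sup>2 / (16 * L)) / (\<epsilon> / 4) = \<epsilon> / 4 * (real l / L)" if "L > 0" for L
        using \<epsilon> that by (simp add: field_simps power2_eq_square)
      show ?thesis unfolding \<delta>_def by (rule eq) simp
    qed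
    also have "\<dots> \<le> \<epsilon> / 4 * 1"
      using \<epsilon> by (intro mult_left_mono) auto
    finally have D_small: "measure M D \<le> \<epsilon> / 4" by simp
    define G' where "G' = G - D - N"
    have G': "G' \<in> sets M" using G(1) D N(3) by (auto simp: G'_def)
    have G'_space: "G' \<subseteq> space M" using sets.sets_into_space[OF G'] .
    have "measure M (space M - G') < \<epsilon>"
    proof -
      have "measure M (space M - G') \<le> measure M ((space M - G) \<union> (D \<union> N))"
        using G(1) D N(3) by (intro finite_measure_mono) (auto simp: G'_def)
      also have "\<dots> \<le> measure M (space M - G) + measure M (D \<union> N)"
        using G(1) D N(3) by (intro measure_Un_le) auto
      also have "measure M (D \<union> N) \<le> measure M D + measure M N"
        using D N(3) by (intro measure_Un_le) auto
      also have "measure M N = 0" using N(2) by (simp add: measure_def)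
      finally show ?thesis using G(2) D_small \<epsilon> by simp
    qed
    then have G'_large: "measure M G' > 1 - \<epsilon>" using prob_compl[OF G'] by simp
    \<comment> \<open>The centres too must avoid \<open>D\<close> and \<open>N\<close>, so each is
      picked inside \<open>G'\<close> from a piece that meets it.\<close>
    define \<P>' where "\<P>' = {P \<in> \<P>. P \<inter> G' \<noteq> {}}"
    define pt where "pt = (\<lambda>P. SOME x. x \<in> P \<inter> G')"
    have pt: "pt P \<in> P \<inter> G'" if "P \<in> \<P>'" for P
    proof -
      have "\<exists>x. x \<in> P \<inter> G'" using that unfolding \<P>'_def by blast
      then show ?thesis unfolding pt_def by (rule someI_ex)
    qed
    define Z where "Z = pt ` \<P>'"
    have fin': "finite \<P>'" using P(1) by (simp add: \<P>'_def)
    have Z: "finite Z" "Z \<subseteq> space M" using fin' pt G'_space by (auto simp: Z_def)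
    have "G' \<subseteq> (\<Union>x\<in>Z. hamming_ball M T l A n x \<epsilon>)"
    proof
      fix y assume y: "y \<in> G'"
      then obtain p where p: "p \<in> \<P>" "y \<in> p" using P(2) by (auto simp: G'_def)
      then have p': "p \<in> \<P>'" using y by (auto simp: \<P>'_def)
      define x where "x = pt p"
      have x: "x \<in> p" "x \<in> G'" using pt[OF p'] by (auto simp: x_def)
      have "(\<Sum>i<n. of_bool (cell_index T l A i x \<noteq> cell_index T l A i y))
          \<le> (\<Sum>i<n. \<rho> ((T ^^ i) x) + \<rho> ((T ^^ i) y) + \<epsilon> / 4)"
      proof (rule sum_mono)
        fix i
        show "of_bool (cell_index T l A i x \<noteq> cell_index T l A i y)
            \<le> \<rho> ((T ^^ i) x) + \<rho> ((T ^^ i) y) + \<epsilon> / 4"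
        proof (rule cell_le)
          show "x \<in> space M - N" "y \<in> space M - N" using x(2) y G'_space by (auto simp: G'_def)
          show "cmod (e x - e y) < s" if "e \<in> EF" for e
            using P_close p(1) x(1) p(2) that by blast
        qed
      qed
      then have "hamming_dist T l A n x y \<le> (\<Sum>i<n. \<rho> ((T ^^ i) x) + \<rho> ((T ^^ i) y) + \<epsilon> / 4) / real n"
        unfolding hamming_dist_eq_sum by (rule divide_right_mono) simp
      also have "\<dots> = R x + R y + \<epsilon> / 4"
        using n by (simp add: R_def sum.distrib add_divide_distrib)
      also have "\<dots> < \<epsilon>"
      proof -
        have "R x < \<epsilon> / 4" "R y < \<epsilon> / 4" using x(2) y G'_space by (auto simp: G'_def D_def)
        then show ?thesis using \<epsilon> by simp
      qed
      finally have "y \<in> hamming_ball M T l A n x \<epsilon>"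
        using y G'_space by (auto simp: hamming_ball_def)
      moreover have "x \<in> Z" using p' by (simp add: Z_def x_def)
      ultimately show "y \<in> (\<Union>x\<in>Z. hamming_ball M T l A n x \<epsilon>)" by blast
    qed
    then have "measure M G' \<le> measure M (\<Union>x\<in>Z. hamming_ball M T l A n x \<epsilon>)"
      using Z(1) by (intro finite_measure_mono sets.finite_UN) auto
    then have "measure_complexity M T n l A \<epsilon> \<le> card Z"
      using G'_large by (intro measure_complexity_le Z) simp
    also have "card Z \<le> card \<P>'" unfolding Z_def using fin' by (rule card_image_le)
    also have "\<dots> \<le> card \<P>" by (rule card_mono[OF P(1)]) (auto simp: \<P>'_def)
    finally show ?thesis .
  qed
  show ?thesis
  \<comment> \<open>The \<open>+ 1\<close> makes the constant positive even if there are no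
    pieces.\<close>
  proof (intro exI[of _ "real (card \<P>) + 1"] conjI allI impI)
    show "real (measure_complexity M T n l A \<epsilon>) \<le> real (card \<P>) + 1" if "n \<ge> 1" for n
      using bound[OF that] by linarith
  qed simp
qed

end

theorem corollary3p2:
  fixes M :: "'a measure" and T :: "'a \<Rightarrow> 'a"
  assumes "lebesgue_space M"
    and "invertible_measure_preserving M T"
  shows "discrete_spectrum M T \<longleftrightarrow>
    (\<forall>(l::nat) (A :: nat \<Rightarrow> 'a set) (\<epsilon>::real).
       finite_measurable_partition M l A \<and> \<epsilon> > 0 \<longrightarrow>
       (\<exists>C::real. C > 0 \<and> (\<forall>n::nat. n \<ge> 1 \<longrightarrow> real (measure_complexity M T n l A \<epsilon>) \<le> C)))"
proof -
  interpret prob_space M using assms(1) by (simp add: lebesgue_space_def)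
  interpret measure_preserving_map M T
    by unfold_locales (use assms(2) in \<open>auto simp: invertible_measure_preserving_def\<close>)
  show ?thesis
  proof (intro iffI allI impI)
    fix l A and \<epsilon> :: real
    assume ds: "discrete_spectrum M T" and A: "finite_measurable_partition M l A \<and> \<epsilon> > 0"
    interpret partitioned_map M T l A by unfold_locales (use A in blast)
    show "\<exists>C>0. \<forall>n\<ge>1. real (measure_complexity M T n l A \<epsilon>) \<le> C"
      using bounded_complexity_if_discrete_spectrum[OF ds] A by blast
  next
    assume bdd: "\<forall>l A \<epsilon>. finite_measurable_partition M l A \<and> \<epsilon> > 0 \<longrightarrow>
      (\<exists>C>0. \<forall>n\<ge>1. real (measure_complexity M T n l A \<epsilon>) \<le> C)"
    show "discrete_spectrum M T"
      by (rule discrete_spectrum_if_bounded_complexity) (use bdd in blast)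
  qed
qed

end
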